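(* Let $\mathbb{K}$ be an algebraically closed field of characteristic $0$. Let $\mathcal{B}$ be a bialgebra over $\mathbb{K}$ and $u$ its unit. Let $\mathcal{B}'$ be the result of adjoining to $\mathcal{B}$ successive unit elements $e$ and $1$ with respect to the multiplication, with the comultiplication $\Delta$ and counit $\varepsilon$ of $\mathcal{B}$ extended linearly to $\mathcal{B}'$ by $$\Delta(1)=1\otimes(e-u)+u\otimes(1-2e+2u),\qquad \Delta(e)=e\otimes(e-u)+u\otimes(2u-e),$$ $$\varepsilon(1)=2,\qquad \varepsilon(e)=2.$$ Then $\mathcal{B}'$ is a weak bialgebra.
   Context: Adjoining successive unit elements $e$ and $1$ to $\mathcal{B}$ means: first form $\mathcal{B}\oplus\mathbb{K}e$, with the multiplication extending that of $\mathcal{B}$ for which $e$ is a unit; then form $\mathcal{B}'=\mathcal{B}\oplus\mathbb{K}e\oplus\mathbb{K}1$, with the multiplication extending that of $\mathcal{B}\oplus\mathbb{K}e$ for which $1$ is a unit. A bialgebra is assumed unital and counital, with $\Delta$ and $\varepsilon$ unital algebra morphisms. Weak bialgebra. Write $xy=m(x\otimes y)$ and use Sweedler notation $\Delta(x)=x_{(1)}\otimes x_{(2)}$ (summation understood). A weak bialgebra is a quintuple $(V,m,\eta,\Delta,\varepsilon)$ with linear maps $m:V\otimes V\to V$, $\eta:\mathbb{K}\to V$ (write $1=\eta(1)$), $\Delta:V\to V\otimes V$, $\varepsilon:V\to\mathbb{K}$ such that: (1) $(V,m,\eta)$ is a unital associative algebra; (2) $(V,\Delta,\varepsilon)$ is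 a coassociative counital coalgebra; (3) for all $x,y,z\in V$: $\Delta(xy)=\Delta(x)\bullet\Delta(y)$; $(\Delta\otimes \mathrm{id})\Delta(1)=(\Delta(1)\otimes 1)\bullet(1\otimes\Delta(1))=(1\otimes\Delta(1))\bullet(\Delta(1)\otimes 1)$; and $\varepsilon(xyz)=\varepsilon(xy_{(1)})\,\varepsilon(y_{(2)}z)$. Here $\bullet$ is the usual componentwise multiplication on tensor powers of $V$. *)

theory Defs
  imports
    "HOL-Computational_Algebra.Polynomial"
    "HOL-Library.Poly_Mapping"
    "HOL-Analysis.Product_Vector"
begin

text \<open>
  Vector spaces are given by a scalar multiplication on a type, as in \<^theory>\<open>HOL.Vector_Spaces\<close>.
  Since the scalar multiplication is a parameter, tensor products cannot form a type. The tensor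
  powers of \<open>V\<close> are sets of cosets: the degree \<open>n\<close> part of the tensor algebra \<open>T(V) = F / N\<close>, where
  \<open>F\<close> is the free vector space on words over \<open>V\<close> and \<open>N\<close> is spanned by the multilinearity relators.
  The relators are homogeneous with respect to word length, so the degree \<open>n\<close> part is the usual
  quotient of the free vector space on \<open>n\<close>-tuples.
\<close>

definition free_scale :: "'k::field \<Rightarrow> ('i \<Rightarrow>\<^sub>0 'k) \<Rightarrow> ('i \<Rightarrow>\<^sub>0 'k)" where
  "free_scale c f = Poly_Mapping.map ((*) c) f"

lemma lookup_free_scale [simp]:
  "poly_mapping.lookup (free_scale c f) i = c * poly_mapping.lookup f i"
  by (simp add: free_scale_def Poly_Mapping.map.rep_eq when_def)

lemma vector_space_free_scale: "vector_space (free_scale :: 'k::field \<Rightarrow> ('i \<Rightarrow>\<^sub>0 'k) \<Rightarrow> _)"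
  by unfold_locales (auto intro!: poly_mapping_eqI simp: lookup_add algebra_simps)

definition free_extend :: "('i \<Rightarrow> 'j \<Rightarrow>\<^sub>0 'k::field) \<Rightarrow> ('i \<Rightarrow>\<^sub>0 'k) \<Rightarrow> ('j \<Rightarrow>\<^sub>0 'k)" where
  "free_extend F f = (\<Sum>i\<in>Poly_Mapping.keys f. free_scale (poly_mapping.lookup f i) (F i))"

abbreviation word :: "'v list \<Rightarrow> 'v list \<Rightarrow>\<^sub>0 'k::field" where
  "word xs \<equiv> Poly_Mapping.single xs 1"

definition tensor_relators ::
    "('k::field \<Rightarrow> 'v::ab_group_add \<Rightarrow> 'v) \<Rightarrow> ('v list \<Rightarrow>\<^sub>0 'k) set" where
  "tensor_relators smul =
     {word (xs @ [a + b] @ ys) - word (xs @ [a] @ ys) - word (xs @ [b] @ ys) | xs a b ys. True} \<union>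
     {word (xs @ [smul c a] @ ys) - free_scale c (word (xs @ [a] @ ys)) | xs c a ys. True}"

definition tensor_null ::
    "('k::field \<Rightarrow> 'v::ab_group_add \<Rightarrow> 'v) \<Rightarrow> ('v list \<Rightarrow>\<^sub>0 'k) set" where
  "tensor_null smul = module.span free_scale (tensor_relators smul)"

type_synonym ('k, 'v) tensor = "('v list \<Rightarrow>\<^sub>0 'k) set"

definition tensor_class ::
    "('k::field \<Rightarrow> 'v::ab_group_add \<Rightarrow> 'v) \<Rightarrow> ('v list \<Rightarrow>\<^sub>0 'k) \<Rightarrow> ('k, 'v) tensor" where
  "tensor_class smul f = {g. g - f \<in> tensor_null smul}"

definition tensor_power ::
    "('k::field \<Rightarrow> 'v::ab_group_add \<Rightarrow> 'v) \<Rightarrow> nat \<Rightarrow> ('k, 'v) tensor set" where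
  "tensor_power smul n =
     tensor_class smul ` {f. \<forall>xs\<in>Poly_Mapping.keys f. length xs = n}"

text \<open>
  Operations on cosets are computed on a representative. A representative of an element of degree \<open>n\<close>
  may contain null terms of other degrees, so operations that are specific to degree 2 or to equal
  degrees send all other words to \<open>0\<close>. Each operation below then maps null terms to null terms,
  which makes the result independent of the representative.
\<close>

definition tensor_rep :: "('k::zero, 'v) tensor \<Rightarrow> ('v list \<Rightarrow>\<^sub>0 'k)" where
  "tensor_rep A = (SOME f. f \<in> A)"

definition pure_tensor ::
    "('k::field \<Rightarrow> 'v::ab_group_add \<Rightarrow> 'v) \<Rightarrow> 'v list \<Rightarrow> ('k, 'v) tensor" where
  "pure_tensor smul xs = tensor_class smul (word xs)"

definition tensor_add ::
    "('k::field \<Rightarrow> 'v::ab_group_add \<Rightarrow> 'v) \<Rightarrow> ('k, 'v) tensor \<Rightarrow> ('k, 'v) tensor \<Rightarrow> ('k, 'v) tensor"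
  where
  "tensor_add smul A B = tensor_class smul (tensor_rep A + tensor_rep B)"

definition tensor_scale ::
    "('k::field \<Rightarrow> 'v::ab_group_add \<Rightarrow> 'v) \<Rightarrow> 'k \<Rightarrow> ('k, 'v) tensor \<Rightarrow> ('k, 'v) tensor" where
  "tensor_scale smul c A = tensor_class smul (free_scale c (tensor_rep A))"

text \<open>The tensor product of two tensors, of degrees \<open>m\<close> and \<open>n\<close> with a result of degree \<open>m + n\<close>:\<close>

definition free_append ::
    "('v list \<Rightarrow>\<^sub>0 'k::field) \<Rightarrow> ('v list \<Rightarrow>\<^sub>0 'k) \<Rightarrow> ('v list \<Rightarrow>\<^sub>0 'k)" where
  "free_append f g = free_extend (\<lambda>xs. free_extend (\<lambda>ys. word (xs @ ys)) g) f"

definition tensor_append ::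
    "('k::field \<Rightarrow> 'v::ab_group_add \<Rightarrow> 'v) \<Rightarrow> ('k, 'v) tensor \<Rightarrow> ('k, 'v) tensor \<Rightarrow> ('k, 'v) tensor"
  where
  "tensor_append smul A B = tensor_class smul (free_append (tensor_rep A) (tensor_rep B))"

text \<open>The componentwise multiplication of tensor powers induced by a bilinear \<open>mul\<close>:\<close>

definition free_mult ::
    "('v \<Rightarrow> 'v \<Rightarrow> 'v) \<Rightarrow> ('v list \<Rightarrow>\<^sub>0 'k::field) \<Rightarrow> ('v list \<Rightarrow>\<^sub>0 'k) \<Rightarrow> ('v list \<Rightarrow>\<^sub>0 'k)" where
  "free_mult mul f g = free_extend (\<lambda>xs. free_extend (\<lambda>ys.
     if length xs = length ys then word (map2 mul xs ys) else 0) g) f"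

definition tensor_mult ::
    "('k::field \<Rightarrow> 'v::ab_group_add \<Rightarrow> 'v) \<Rightarrow> ('v \<Rightarrow> 'v \<Rightarrow> 'v) \<Rightarrow>
     ('k, 'v) tensor \<Rightarrow> ('k, 'v) tensor \<Rightarrow> ('k, 'v) tensor" where
  "tensor_mult smul mul A B = tensor_class smul (free_mult mul (tensor_rep A) (tensor_rep B))"

text \<open>The map \<open>p \<otimes> q\<close> on degree 2, for linear \<open>p\<close> and \<open>q\<close> with values in tensor powers:\<close>

definition tensor_map2 ::
    "('k::field \<Rightarrow> 'v::ab_group_add \<Rightarrow> 'v) \<Rightarrow> ('v \<Rightarrow> ('k, 'v) tensor) \<Rightarrow> ('v \<Rightarrow> ('k, 'v) tensor) \<Rightarrow>
     ('k, 'v) tensor \<Rightarrow> ('k, 'v) tensor" where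
  "tensor_map2 smul p q A = tensor_class smul (free_extend
     (\<lambda>xs. case xs of
             [a, b] \<Rightarrow> free_append (tensor_rep (p a)) (tensor_rep (q b))
           | _ \<Rightarrow> 0) (tensor_rep A))"

text \<open>The map of tensor powers induced by a linear map \<open>h\<close> into a space with scalar
  multiplication \<open>smul\<close>:\<close>

definition tensor_map ::
    "('k::field \<Rightarrow> 'w::ab_group_add \<Rightarrow> 'w) \<Rightarrow> ('v \<Rightarrow> 'w) \<Rightarrow> ('k, 'v) tensor \<Rightarrow> ('k, 'w) tensor" where
  "tensor_map smul h A =
     tensor_class smul (free_extend (\<lambda>xs. word (map h xs)) (tensor_rep A))"

text \<open>The Sweedler sum \<open>\<Sum> B x\<^sub>1 x\<^sub>2\<close> of a degree 2 tensor \<open>\<Sum> x\<^sub>1 \<otimes> x\<^sub>2\<close>, for a bilinear map \<open>B\<close>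
  into a space with scalar multiplication \<open>smul\<close>:\<close>

definition sweedler ::
    "('k::field \<Rightarrow> 'w::ab_group_add \<Rightarrow> 'w) \<Rightarrow> ('v \<Rightarrow> 'v \<Rightarrow> 'w) \<Rightarrow> ('k, 'v) tensor \<Rightarrow> 'w" where
  "sweedler smul B A = (\<Sum>xs\<in>Poly_Mapping.keys (tensor_rep A).
     smul (poly_mapping.lookup (tensor_rep A) xs) (case xs of [a, b] \<Rightarrow> B a b | _ \<Rightarrow> 0))"


text \<open>A linear map \<open>V \<otimes> V \<Rightarrow> V\<close> is given as a bilinear map, and a linear map from the field to \<open>V\<close>
  as the image \<open>one\<close> of \<open>1\<close>.\<close>

locale unital_algebra = vector_space smul
  for smul :: "'k::field \<Rightarrow> 'v::ab_group_add \<Rightarrow> 'v" +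
  fixes mul :: "'v \<Rightarrow> 'v \<Rightarrow> 'v" and one :: 'v
  assumes linear_mult_right: "\<And>x. Vector_Spaces.linear smul smul (\<lambda>y. mul x y)"
    and linear_mult_left: "\<And>y. Vector_Spaces.linear smul smul (\<lambda>x. mul x y)"
    and mult_assoc: "\<And>x y z. mul (mul x y) z = mul x (mul y z)"
    and mult_one_left: "\<And>x. mul one x = x"
    and mult_one_right: "\<And>x. mul x one = x"

locale counital_coalgebra = vector_space smul
  for smul :: "'k::field \<Rightarrow> 'v::ab_group_add \<Rightarrow> 'v" +
  fixes \<Delta> :: "'v \<Rightarrow> ('k, 'v) tensor" and \<epsilon> :: "'v \<Rightarrow> 'k"
  assumes comult_in: "\<And>x. \<Delta> x \<in> tensor_power smul 2"
    and comult_add: "\<And>x y. \<Delta> (x + y) = tensor_add smul (\<Delta> x) (\<Delta> y)"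
    and comult_scale: "\<And>c x. \<Delta> (smul c x) = tensor_scale smul c (\<Delta> x)"
    and linear_counit: "Vector_Spaces.linear smul (*) \<epsilon>"
    and coassoc: "\<And>x. tensor_map2 smul \<Delta> (\<lambda>v. pure_tensor smul [v]) (\<Delta> x) =
                       tensor_map2 smul (\<lambda>v. pure_tensor smul [v]) \<Delta> (\<Delta> x)"
    and counit_left: "\<And>x. sweedler smul (\<lambda>a b. smul (\<epsilon> a) b) (\<Delta> x) = x"
    and counit_right: "\<And>x. sweedler smul (\<lambda>a b. smul (\<epsilon> b) a) (\<Delta> x) = x"

locale bialgebra =
  unital_algebra smul mul one + counital_coalgebra smul \<Delta> \<epsilon>
  for smul :: "'k::field \<Rightarrow> 'v::ab_group_add \<Rightarrow> 'v"
    and mul :: "'v \<Rightarrow> 'v \<Rightarrow> 'v" and one :: 'v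
    and \<Delta> :: "'v \<Rightarrow> ('k, 'v) tensor" and \<epsilon> :: "'v \<Rightarrow> 'k" +
  assumes comult_mult: "\<And>x y. \<Delta> (mul x y) = tensor_mult smul mul (\<Delta> x) (\<Delta> y)"
    and comult_one: "\<Delta> one = pure_tensor smul [one, one]"
    and counit_mult: "\<And>x y. \<epsilon> (mul x y) = \<epsilon> x * \<epsilon> y"
    and counit_one: "\<epsilon> one = 1"

locale weak_bialgebra =
  unital_algebra smul mul one + counital_coalgebra smul \<Delta> \<epsilon>
  for smul :: "'k::field \<Rightarrow> 'v::ab_group_add \<Rightarrow> 'v"
    and mul :: "'v \<Rightarrow> 'v \<Rightarrow> 'v" and one :: 'v
    and \<Delta> :: "'v \<Rightarrow> ('k, 'v) tensor" and \<epsilon> :: "'v \<Rightarrow> 'k" +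
  assumes comult_mult: "\<And>x y. \<Delta> (mul x y) = tensor_mult smul mul (\<Delta> x) (\<Delta> y)"
    and weak_comult_one_left:
      "tensor_map2 smul \<Delta> (\<lambda>v. pure_tensor smul [v]) (\<Delta> one) =
       tensor_mult smul mul (tensor_append smul (\<Delta> one) (pure_tensor smul [one]))
                              (tensor_append smul (pure_tensor smul [one]) (\<Delta> one))"
    and weak_comult_one_right:
      "tensor_map2 smul \<Delta> (\<lambda>v. pure_tensor smul [v]) (\<Delta> one) =
       tensor_mult smul mul (tensor_append smul (pure_tensor smul [one]) (\<Delta> one))
                              (tensor_append smul (\<Delta> one) (pure_tensor smul [one]))"
    and weak_counit_mult:
      "\<And>x y z. \<epsilon> (mul (mul x y) z) =
         sweedler (*) (\<lambda>y1 y2. \<epsilon> (mul x y1) * \<epsilon> (mul y2 z)) (\<Delta> y)"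


text \<open>Adjoining a unit element: \<open>(a, s)\<close> stands for \<open>a + s e\<close>.\<close>

definition adjoin_scale ::
    "('k::field \<Rightarrow> 'v::ab_group_add \<Rightarrow> 'v) \<Rightarrow> 'k \<Rightarrow> 'v \<times> 'k \<Rightarrow> 'v \<times> 'k" where
  "adjoin_scale smul = module_prod.scale smul (*)"

definition adjoin_mult ::
    "('k::field \<Rightarrow> 'v::ab_group_add \<Rightarrow> 'v) \<Rightarrow> ('v \<Rightarrow> 'v \<Rightarrow> 'v) \<Rightarrow> 'v \<times> 'k \<Rightarrow> 'v \<times> 'k \<Rightarrow> 'v \<times> 'k" where
  "adjoin_mult smul mul =
     (\<lambda>(a, s) (b, t). (mul a b + smul t a + smul s b, s * t))"

definition adjoin_embed :: "'v \<Rightarrow> 'v \<times> 'k::field" where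
  "adjoin_embed a = (a, 0)"

definition adjoin_unit :: "'v::ab_group_add \<times> 'k::field" where
  "adjoin_unit = (0, 1)"

text \<open>The linear extensions of \<open>\<Delta>\<close> and \<open>\<epsilon>\<close> to the space with two units \<open>e\<close> and \<open>1\<close> adjoined,
  with prescribed values at \<open>e\<close> and \<open>1\<close>. Here \<open>((b, s), t)\<close> stands for \<open>b + s e + t 1\<close>.\<close>

definition extend_comult ::
    "('k::field \<Rightarrow> 'v::ab_group_add \<Rightarrow> 'v) \<Rightarrow> ('v \<Rightarrow> ('k, 'v) tensor) \<Rightarrow>
     ('k, ('v \<times> 'k) \<times> 'k) tensor \<Rightarrow> ('k, ('v \<times> 'k) \<times> 'k) tensor \<Rightarrow>
     ('v \<times> 'k) \<times> 'k \<Rightarrow> ('k, ('v \<times> 'k) \<times> 'k) tensor" where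
  "extend_comult smul \<Delta> \<Delta>e \<Delta>1 = (\<lambda>((b, s), t).
     let smul' = adjoin_scale (adjoin_scale smul)
     in tensor_add smul'
          (tensor_add smul'
             (tensor_map smul' (\<lambda>v. adjoin_embed (adjoin_embed v)) (\<Delta> b))
             (tensor_scale smul' s \<Delta>e))
          (tensor_scale smul' t \<Delta>1))"

definition extend_counit ::
    "('v \<Rightarrow> 'k::field) \<Rightarrow> 'k \<Rightarrow> 'k \<Rightarrow> ('v \<times> 'k) \<times> 'k \<Rightarrow> 'k" where
  "extend_counit \<epsilon> \<epsilon>e \<epsilon>1 = (\<lambda>((b, s), t). \<epsilon> b + s * \<epsilon>e + t * \<epsilon>1)"

end

theory Submission
  imports Defs
begin

text \<open>
  Put \<open>f = e - u\<close> and \<open>g = 1 - e\<close>. Since \<open>e\<close> is a unit for \<open>\<B>\<close> and \<open>1\<close> is a unit for everything,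
  \<open>u\<close>, \<open>f\<close>, \<open>g\<close> are orthogonal idempotents with sum \<open>1\<close>, and \<open>f\<close> and \<open>g\<close> annihilate \<open>\<B>\<close>. So the
  extended algebra is the product of \<open>\<B>\<close> with two copies of the field. In this basis the
  prescribed values become
  \<open>\<Delta>(f) = f \<otimes> f\<close>, \<open>\<Delta>(g) = g \<otimes> f + u \<otimes> g\<close>, \<open>\<epsilon>(f) = 1\<close> and \<open>\<epsilon>(g) = 0\<close>: the element \<open>f\<close> is group-like
  and \<open>g\<close> is skew-primitive between the group-like elements \<open>u\<close> and \<open>f\<close>. Hence the coalgebra axioms
  hold (\<open>coassoc_comult'\<close>, \<open>counit'_left\<close>, \<open>counit'_right\<close>).

  Multiplicativity of \<open>\<Delta>\<close> can be tested on \<open>\<B>\<close>, \<open>f\<close> and \<open>g\<close> separately: each of the three parts is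
  multiplicative by itself, and the products of different parts vanish on both sides
  (\<open>comult'_mult\<close>). The unit \<open>1\<close> is not group-like, since
  \<open>\<Delta>(1) = u \<otimes> (u + g) + (f + g) \<otimes> f\<close>; the weak unit axioms are a computation with orthogonal
  idempotents (\<open>comult'_comult'_one\<close>, \<open>weak_comult'_one\<close>). The weak counit axiom is linear in its
  middle argument, so it too is tested on the three parts (\<open>weak_counit'_mult\<close>).

  Tensors are cosets of a free vector space on words, so each operation on tensors is first
  computed on representatives, and identities between tensors are proved up to the congruence \<open>\<approx>\<close> modulo the
  multilinearity relations. That the operations respect this congruence is the universal property
  \<open>linear_extend_tensor_null\<close>.
\<close>

section \<open>Linear extension from a free vector space\<close>

definition linear_extend ::
    "('k::field \<Rightarrow> 'w::ab_group_add \<Rightarrow> 'w) \<Rightarrow> ('i \<Rightarrow> 'w) \<Rightarrow> ('i \<Rightarrow>\<^sub>0 'k) \<Rightarrow> 'w" where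
  "linear_extend smul F f =
     (\<Sum>i\<in>Poly_Mapping.keys f. smul (poly_mapping.lookup f i) (F i))"

lemma free_extend_eq_linear_extend: "free_extend F f = linear_extend free_scale F f"
  by (simp add: free_extend_def linear_extend_def)

context vector_space
begin

lemma linear_extend_superset:
  assumes "finite A" "Poly_Mapping.keys f \<subseteq> A"
  shows "linear_extend scale F f = (\<Sum>i\<in>A. scale (poly_mapping.lookup f i) (F i))"
  unfolding linear_extend_def
  by (rule sum.mono_neutral_left) (use assms in \<open>auto simp: in_keys_iff\<close>)

lemma linear_extend_add [simp]:
  "linear_extend scale F (f + g) = linear_extend scale F f + linear_extend scale F g"
proof -
  let ?A = "Poly_Mapping.keys f \<union> Poly_Mapping.keys g"
  have "Poly_Mapping.keys (f + g) \<subseteq> ?A"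
    by (rule Poly_Mapping.keys_add)
  then show ?thesis
    by (simp add: linear_extend_superset[of ?A] lookup_add scale_left_distrib sum.distrib)
qed

lemma linear_extend_scale [simp]:
  "linear_extend scale F (free_scale c f) = scale c (linear_extend scale F f)"
proof -
  have "Poly_Mapping.keys (free_scale c f) \<subseteq> Poly_Mapping.keys f"
    by (auto simp: in_keys_iff)
  then show ?thesis
    by (simp add: linear_extend_superset[of "Poly_Mapping.keys f"] scale_sum_right)
qed

lemma linear_extend_zero [simp]: "linear_extend scale F 0 = 0"
  by (simp add: linear_extend_def)

lemma linear_extend_diff [simp]:
  "linear_extend scale F (f - g) = linear_extend scale F f - linear_extend scale F g"
  using linear_extend_add[of F "f - g" g] by (simp add: algebra_simps)

lemma linear_extend_single [simp]: "linear_extend scale F (Poly_Mapping.single i 1) = F i"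
  by (simp add: linear_extend_def)

lemma linear_linear_extend: "Vector_Spaces.linear free_scale scale (linear_extend scale F)"
  by (intro module_hom_iff_linear[THEN iffD1] module_hom.intro module_hom_axioms.intro
      vector_space_free_scale[folded module_iff_vector_space] module_axioms) simp_all

lemma linear_extend_in_subspace:
  assumes "subspace S" "\<And>i. i \<in> Poly_Mapping.keys f \<Longrightarrow> F i \<in> S"
  shows "linear_extend scale F f \<in> S"
  unfolding linear_extend_def by (intro subspace_sum subspace_scale assms)

lemma linear_extend_fun_add:
  "linear_extend scale (\<lambda>i. F i + G i) f = linear_extend scale F f + linear_extend scale G f"
  by (simp add: linear_extend_def scale_right_distrib sum.distrib)

lemma linear_extend_fun_diff:
  "linear_extend scale (\<lambda>i. F i - G i) f = linear_extend scale F f - linear_extend scale G f"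
  by (simp add: linear_extend_def scale_right_diff_distrib sum_subtractf)

lemma linear_extend_fun_scale:
  "linear_extend scale (\<lambda>i. scale c (F i)) f = scale c (linear_extend scale F f)"
  by (simp add: linear_extend_def scale_sum_right mult.commute)

lemma linear_extend_fun_zero [simp]: "linear_extend scale (\<lambda>i. 0) f = 0"
  by (simp add: linear_extend_def)

end

lemma linear_extend_cong:
  "(\<And>i. i \<in> Poly_Mapping.keys f \<Longrightarrow> F i = G i) \<Longrightarrow>
    linear_extend smul' F f = linear_extend smul' G f"
  by (simp add: linear_extend_def)

lemma linear_apply_linear_extend:
  assumes "Vector_Spaces.linear s1 s2 L"
  shows "L (linear_extend s1 F f) = linear_extend s2 (\<lambda>i. L (F i)) f"
proof -
  interpret L: Vector_Spaces.linear s1 s2 L by fact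
  show ?thesis by (simp add: linear_extend_def L.sum L.scale)
qed

interpretation free: vector_space "free_scale :: 'k::field \<Rightarrow> ('i \<Rightarrow>\<^sub>0 'k) \<Rightarrow> ('i \<Rightarrow>\<^sub>0 'k)"
  by (rule vector_space_free_scale)

lemma linear_extend_compose:
  assumes "vector_space smul'"
  shows "linear_extend smul' F (linear_extend free_scale G f)
       = linear_extend smul' (\<lambda>i. linear_extend smul' F (G i)) f"
  by (rule linear_apply_linear_extend[OF vector_space.linear_linear_extend[OF assms]])

lemma subspace_homogeneous: "free.subspace {f. \<forall>xs\<in>Poly_Mapping.keys f. length xs = n}"
  by (rule free.subspaceI)
    (use Poly_Mapping.keys_add in \<open>fastforce simp: in_keys_iff\<close>)+

section \<open>Congruence modulo the multilinearity relations\<close>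

definition tensor_cong ::
    "('v list \<Rightarrow>\<^sub>0 'k) \<Rightarrow> ('k::field \<Rightarrow> 'v::ab_group_add \<Rightarrow> 'v) \<Rightarrow> ('v list \<Rightarrow>\<^sub>0 'k) \<Rightarrow> bool"
    ("(_ \<approx>\<^bsub>_\<^esub> _)" [51, 0, 51] 50) where
  "f \<approx>\<^bsub>smul\<^esub> g \<longleftrightarrow> f - g \<in> tensor_null smul"

lemma subspace_tensor_null: "free.subspace (tensor_null smul)"
  by (simp add: tensor_null_def)

lemma tensor_cong_refl [simp, intro]: "f \<approx>\<^bsub>smul\<^esub> f"
  by (simp add: tensor_cong_def free.subspace_0[OF subspace_tensor_null])

lemma tensor_cong_sym: "f \<approx>\<^bsub>smul\<^esub> g \<Longrightarrow> g \<approx>\<^bsub>smul\<^esub> f"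
  using free.subspace_neg[OF subspace_tensor_null] by (fastforce simp: tensor_cong_def)

lemma tensor_cong_add:
  "f \<approx>\<^bsub>smul\<^esub> f' \<Longrightarrow> g \<approx>\<^bsub>smul\<^esub> g' \<Longrightarrow> f + g \<approx>\<^bsub>smul\<^esub> f' + g'"
  using free.subspace_add[OF subspace_tensor_null, of "f - f'" smul "g - g'"]
  by (simp add: tensor_cong_def algebra_simps)

lemma tensor_cong_scale: "f \<approx>\<^bsub>smul\<^esub> f' \<Longrightarrow> free_scale c f \<approx>\<^bsub>smul\<^esub> free_scale c f'"
  using free.subspace_scale[OF subspace_tensor_null, of "f - f'" smul c]
  by (simp add: tensor_cong_def free.scale_right_diff_distrib)

lemma tensor_cong_trans [trans]:
  "f \<approx>\<^bsub>smul\<^esub> g \<Longrightarrow> g \<approx>\<^bsub>smul\<^esub> h \<Longrightarrow> f \<approx>\<^bsub>smul\<^esub> h"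
  using free.subspace_add[OF subspace_tensor_null, of "f - g" smul "g - h"]
  by (simp add: tensor_cong_def)

text \<open>Explicit rules for chains that mix equality with the congruence; the alternative is
  substitution under an arbitrary context, where higher-order unification has very many solutions.\<close>

lemma tensor_cong_eq_trans [trans]: "f \<approx>\<^bsub>smul\<^esub> g \<Longrightarrow> g = h \<Longrightarrow> f \<approx>\<^bsub>smul\<^esub> h"
  by simp

lemma eq_tensor_cong_trans [trans]: "f = g \<Longrightarrow> g \<approx>\<^bsub>smul\<^esub> h \<Longrightarrow> f \<approx>\<^bsub>smul\<^esub> h"
  by simp

lemma linear_extend_tensor_cong:
  assumes "\<And>i. i \<in> Poly_Mapping.keys f \<Longrightarrow> F i \<approx>\<^bsub>smul\<^esub> G i"
  shows "linear_extend free_scale F f \<approx>\<^bsub>smul\<^esub> linear_extend free_scale G f"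
  using free.linear_extend_in_subspace[OF subspace_tensor_null, of f "\<lambda>i. F i - G i"] assms
  by (simp add: tensor_cong_def free.linear_extend_fun_diff)

lemma word_add:
  "word (xs @ [a + b] @ ys) \<approx>\<^bsub>smul\<^esub> word (xs @ [a] @ ys) + word (xs @ [b] @ ys)"
  unfolding tensor_cong_def tensor_null_def
  by (rule free.span_base) (force simp: tensor_relators_def algebra_simps)

lemma word_scale: "word (xs @ [smul c a] @ ys) \<approx>\<^bsub>smul\<^esub> free_scale c (word (xs @ [a] @ ys))"
  unfolding tensor_cong_def tensor_null_def
  by (rule free.span_base) (force simp: tensor_relators_def)

lemma word_zero: "word (xs @ [0] @ ys) \<approx>\<^bsub>smul\<^esub> 0"
  using tensor_cong_sym[OF word_add[of xs 0 0 ys smul]] by (simp add: tensor_cong_def)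

lemma mem_tensor_class: "f \<in> tensor_class smul f"
  by (simp add: tensor_class_def free.subspace_0[OF subspace_tensor_null])

lemma tensor_class_eq_iff:
  "tensor_class smul f = tensor_class smul g \<longleftrightarrow> f \<approx>\<^bsub>smul\<^esub> g"
proof
  assume "tensor_class smul f = tensor_class smul g"
  then have "f \<in> tensor_class smul g"
    using mem_tensor_class by blast
  then show "f \<approx>\<^bsub>smul\<^esub> g" by (simp add: tensor_class_def tensor_cong_def)
next
  assume "f \<approx>\<^bsub>smul\<^esub> g"
  then show "tensor_class smul f = tensor_class smul g"
    by (auto simp: tensor_class_def simp flip: tensor_cong_def
        intro: tensor_cong_trans tensor_cong_sym)
qed

lemma tensor_rep_class: "tensor_rep (tensor_class smul f) \<approx>\<^bsub>smul\<^esub> f"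
proof -
  have "tensor_rep (tensor_class smul f) \<in> tensor_class smul f"
    unfolding tensor_rep_def by (rule someI, rule mem_tensor_class)
  then show ?thesis by (simp add: tensor_class_def tensor_cong_def)
qed

section \<open>Descent of multilinear constructions\<close>

definition multilinear_mod ::
    "('k::field \<Rightarrow> 'v::ab_group_add \<Rightarrow> 'v) \<Rightarrow> ('k \<Rightarrow> 'w::ab_group_add \<Rightarrow> 'w) \<Rightarrow> 'w set \<Rightarrow>
     ('v list \<Rightarrow> 'w) \<Rightarrow> bool" where
  "multilinear_mod smul smul' S H \<longleftrightarrow>
     (\<forall>xs a b ys. H (xs @ [a + b] @ ys) - H (xs @ [a] @ ys) - H (xs @ [b] @ ys) \<in> S) \<and>
     (\<forall>xs c a ys. H (xs @ [smul c a] @ ys) - smul' c (H (xs @ [a] @ ys)) \<in> S)"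

text \<open>The universal property of the tensor algebra, in the form used for every operation below. The
  target carries a subspace \<open>S\<close> of terms to be ignored: null terms when the values are again
  representatives of tensors, \<open>{0}\<close> when they are honest vectors.\<close>

lemma (in vector_space) linear_extend_tensor_null:
  assumes "multilinear_mod smul scale S H" "subspace S" "f \<in> tensor_null smul"
  shows "linear_extend scale H f \<in> S"
  using assms(3) unfolding tensor_null_def
proof (induction rule: free.span_induct)
  case base
  then show ?case
    using module_hom.subspace_linear_preimage[OF
        linear_linear_extend[unfolded module_hom_iff_linear[symmetric]] assms(2)]
    by (simp add: free.subspace_def)
next
  case (step r)
  then show ?case
    using assms(1) by (auto simp: tensor_relators_def multilinear_mod_def)
qed

lemma linear_extend_respects_cong:
  assumes "multilinear_mod smul free_scale (tensor_null smul') H" "f \<approx>\<^bsub>smul\<^esub> g"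
  shows "linear_extend free_scale H f \<approx>\<^bsub>smul'\<^esub> linear_extend free_scale H g"
  using free.linear_extend_tensor_null[OF assms(1) subspace_tensor_null] assms(2)
  by (fastforce simp: tensor_cong_def)

lemma (in vector_space) linear_extend_respects_cong_eq:
  assumes "multilinear_mod smul scale {0} H" "f \<approx>\<^bsub>smul\<^esub> g"
  shows "linear_extend scale H f = linear_extend scale H g"
  using linear_extend_tensor_null[OF assms(1) subspace_single_0, of "f - g"] assms(2)
  by (simp add: tensor_cong_def)

lemma bilinear_extend_respects_cong:
  assumes 1: "\<And>ys. multilinear_mod smul free_scale (tensor_null smul) (\<lambda>xs. G xs ys)"
    and 2: "\<And>xs. multilinear_mod smul free_scale (tensor_null smul) (\<lambda>ys. G xs ys)"
    and f: "f \<approx>\<^bsub>smul\<^esub> f'" and g: "g \<approx>\<^bsub>smul\<^esub> g'"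
  shows "linear_extend free_scale (\<lambda>xs. linear_extend free_scale (G xs) g) f
    \<approx>\<^bsub>smul\<^esub> linear_extend free_scale (\<lambda>xs. linear_extend free_scale (G xs) g') f'"
proof -
  have "multilinear_mod smul free_scale (tensor_null smul)
      (\<lambda>xs. linear_extend free_scale (G xs) g)"
    unfolding multilinear_mod_def free.linear_extend_fun_diff[symmetric]
      free.linear_extend_fun_scale[symmetric]
    using 1 unfolding multilinear_mod_def
    by (blast intro: free.linear_extend_in_subspace[OF subspace_tensor_null])
  then have "linear_extend free_scale (\<lambda>xs. linear_extend free_scale (G xs) g) f
      \<approx>\<^bsub>smul\<^esub> linear_extend free_scale (\<lambda>xs. linear_extend free_scale (G xs) g) f'"
    using f by (rule linear_extend_respects_cong)
  also have "\<dots> \<approx>\<^bsub>smul\<^esub> linear_extend free_scale (\<lambda>xs. linear_extend free_scale (G xs) g') f'"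
    by (intro linear_extend_tensor_cong linear_extend_respects_cong[OF 2 g])
  finally show ?thesis .
qed

lemma free_append_eq:
  "free_append f g
    = linear_extend free_scale (\<lambda>xs. linear_extend free_scale (\<lambda>ys. word (xs @ ys)) g) f"
  by (simp add: free_append_def free_extend_eq_linear_extend)

lemma free_mult_eq:
  "free_mult mul f g
    = linear_extend free_scale (\<lambda>xs. linear_extend free_scale
        (\<lambda>ys. if length xs = length ys then word (map2 mul xs ys) else 0) g) f"
  by (simp add: free_mult_def free_extend_eq_linear_extend)

lemma free_append_word [simp]: "free_append (word xs) (word ys) = word (xs @ ys)"
  by (simp add: free_append_eq)

lemma free_append_add_left [simp]:
  "free_append (f + f') g = free_append f g + free_append f' g"
  by (simp add: free_append_eq)

lemma free_append_add_right [simp]: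
  "free_append f (g + g') = free_append f g + free_append f g'"
  by (simp add: free_append_eq free.linear_extend_fun_add)

lemma free_append_scale_left [simp]:
  "free_append (free_scale c f) g = free_scale c (free_append f g)"
  by (simp add: free_append_eq)

lemma free_append_scale_right [simp]:
  "free_append f (free_scale c g) = free_scale c (free_append f g)"
  by (simp add: free_append_eq free.linear_extend_fun_scale)

lemma free_mult_word [simp]:
  "length xs = length ys \<Longrightarrow> free_mult mul (word xs) (word ys) = word (map2 mul xs ys)"
  by (simp add: free_mult_eq)

lemma free_mult_add_left [simp]:
  "free_mult mul (f + f') g = free_mult mul f g + free_mult mul f' g"
  by (simp add: free_mult_eq)

lemma free_mult_add_right [simp]:
  "free_mult mul f (g + g') = free_mult mul f g + free_mult mul f g'"
  by (simp add: free_mult_eq free.linear_extend_fun_add)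

lemma free_mult_scale_left [simp]:
  "free_mult mul (free_scale c f) g = free_scale c (free_mult mul f g)"
  by (simp add: free_mult_eq)

lemma free_mult_scale_right [simp]:
  "free_mult mul f (free_scale c g) = free_scale c (free_mult mul f g)"
  by (simp add: free_mult_eq free.linear_extend_fun_scale)

lemma free_append_cong:
  assumes "f \<approx>\<^bsub>smul\<^esub> f'" "g \<approx>\<^bsub>smul\<^esub> g'"
  shows "free_append f g \<approx>\<^bsub>smul\<^esub> free_append f' g'"
  unfolding free_append_eq
proof (rule bilinear_extend_respects_cong[OF _ _ assms])
  show "multilinear_mod smul free_scale (tensor_null smul) (\<lambda>xs. word (xs @ ys))" for ys
    using word_add[of _ _ _ "_ @ ys" smul] word_scale[of _ smul _ _ "_ @ ys"]
    by (simp add: multilinear_mod_def tensor_cong_def diff_diff_add)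
  show "multilinear_mod smul free_scale (tensor_null smul) (\<lambda>ys. word (xs @ ys))" for xs
    using word_add[of "xs @ _" _ _ _ smul] word_scale[of "xs @ _" smul _ _ _]
    by (simp add: multilinear_mod_def tensor_cong_def diff_diff_add)
qed

text \<open>Componentwise multiplication sends pairs of words of different lengths to \<open>0\<close>. Both sides of a
  multilinearity relation consist of words of one length, so this convention is consistent with
  them.\<close>

lemma multilinear_map2_word:
  fixes mul :: "'v::ab_group_add \<Rightarrow> 'v \<Rightarrow> 'v"
  assumes mul: "\<And>x. Vector_Spaces.linear smul smul (\<lambda>y. mul x y)"
  shows "multilinear_mod smul free_scale (tensor_null smul)
    (\<lambda>ys. if length xs = length ys then word (map2 mul xs ys) else 0)"
    (is "multilinear_mod _ _ _ ?H")
proof -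
  have split: "\<exists>us z vs. xs = us @ [z] @ vs \<and> length us = length ps \<and> length vs = length qs"
    if "length xs = length ps + 1 + length qs" for ps qs :: "'v list"
  proof -
    have "xs = take (length ps) xs @ [xs ! length ps] @ drop (Suc (length ps)) xs"
      using that by (simp add: id_take_nth_drop[symmetric])
    moreover have "length (take (length ps) xs) = length ps"
      and "length (drop (Suc (length ps)) xs) = length qs"
      using that by simp_all
    ultimately show ?thesis by blast
  qed
  have add: "mul x (a + b) = mul x a + mul x b" for x a b
    by (rule module_hom.add[OF mul[unfolded module_hom_iff_linear[symmetric]]])
  have scale: "mul x (smul c a) = smul c (mul x a)" for x c a
    by (rule module_hom.scale[OF mul[unfolded module_hom_iff_linear[symmetric]]])
  have "?H (ps @ [a + b] @ qs) \<approx>\<^bsub>smul\<^esub> ?H (ps @ [a] @ qs) + ?H (ps @ [b] @ qs)"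
    for ps qs a b
  proof (cases "length xs = length ps + 1 + length qs")
    case True
    then obtain us z vs where "xs = us @ [z] @ vs" "length us = length ps" "length vs = length qs"
      using split by blast
    then show ?thesis
      using word_add[of "map2 mul us ps" "mul z a" "mul z b" "map2 mul vs qs" smul]
      by (simp add: add)
  qed simp
  moreover
  have "?H (ps @ [smul c a] @ qs) \<approx>\<^bsub>smul\<^esub> free_scale c (?H (ps @ [a] @ qs))"
    for ps qs c a
  proof (cases "length xs = length ps + 1 + length qs")
    case True
    then obtain us z vs where "xs = us @ [z] @ vs" "length us = length ps" "length vs = length qs"
      using split by blast
    then show ?thesis
      using word_scale[of "map2 mul us ps" smul c "mul z a" "map2 mul vs qs"]
      by (simp add: scale)
  qed simp
  ultimately show ?thesis
    unfolding multilinear_mod_def tensor_cong_def diff_diff_add by blast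
qed

lemma free_mult_cong:
  fixes smul :: "'k::field \<Rightarrow> 'v::ab_group_add \<Rightarrow> 'v"
    and mul :: "'v \<Rightarrow> 'v \<Rightarrow> 'v"
  assumes right: "\<And>x. Vector_Spaces.linear smul smul (\<lambda>y. mul x y)"
    and left: "\<And>y. Vector_Spaces.linear smul smul (\<lambda>x. mul x y)"
    and f: "f \<approx>\<^bsub>smul\<^esub> f'" and g: "g \<approx>\<^bsub>smul\<^esub> g'"
  shows "free_mult mul f g \<approx>\<^bsub>smul\<^esub> free_mult mul f' g'"
  unfolding free_mult_eq
proof (rule bilinear_extend_respects_cong[OF _ multilinear_map2_word[OF right] f g])
  fix ys :: "'v list"
  have "map2 mul xs ys = map2 (\<lambda>y x. mul x y) ys xs" for xs
    by (subst zip_commute) (simp add: case_prod_beta)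
  then have "(\<lambda>xs. if length xs = length ys then word (map2 mul xs ys) else 0)
      = (\<lambda>xs. if length ys = length xs then word (map2 (\<lambda>y x. mul x y) ys xs)
           else (0 :: 'v list \<Rightarrow>\<^sub>0 'k))"
    by (intro ext) (simp add: eq_commute[of "length ys"])
  then show "multilinear_mod smul free_scale (tensor_null smul)
      (\<lambda>xs. if length xs = length ys then word (map2 mul xs ys) else 0)"
    using multilinear_map2_word[of smul "\<lambda>y x. mul x y" ys, OF left] by (simp only:)
qed

text \<open>The relations in degree 2 are those of bilinearity, and in the other degrees there is nothing to
  check, because every term of a relation is sent to \<open>0\<close>.\<close>

lemma multilinear_mod_pairs:
  assumes "0 \<in> S" "\<And>c. smul' c 0 = 0"
    and "\<And>a a' b. B (a + a') b - B a b - B a' b \<in> S"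
    and "\<And>a b b'. B a (b + b') - B a b - B a b' \<in> S"
    and "\<And>c a b. B (smul c a) b - smul' c (B a b) \<in> S"
    and "\<And>c a b. B a (smul c b) - smul' c (B a b) \<in> S"
  shows "multilinear_mod smul smul' S (\<lambda>xs. case xs of [a, b] \<Rightarrow> B a b | _ \<Rightarrow> 0)"
  unfolding multilinear_mod_def
  by (auto split: list.splits simp: append_eq_Cons_conv Cons_eq_append_conv assms)

section \<open>Operations on tensors, computed on representatives\<close>

definition pair_extend ::
    "('k::field \<Rightarrow> 'w::ab_group_add \<Rightarrow> 'w) \<Rightarrow> ('v \<Rightarrow> 'v \<Rightarrow> 'w) \<Rightarrow> ('v list \<Rightarrow>\<^sub>0 'k) \<Rightarrow> 'w" where
  "pair_extend smul B = linear_extend smul (\<lambda>xs. case xs of [a, b] \<Rightarrow> B a b | _ \<Rightarrow> 0)"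

definition free_map :: "('v \<Rightarrow> 'w) \<Rightarrow> ('v list \<Rightarrow>\<^sub>0 'k::field) \<Rightarrow> ('w list \<Rightarrow>\<^sub>0 'k)" where
  "free_map h = linear_extend free_scale (\<lambda>xs. word (map h xs))"

lemma (in vector_space) pair_extend_simps [simp]:
  "pair_extend scale B (f + g) = pair_extend scale B f + pair_extend scale B g"
  "pair_extend scale B (free_scale c f) = scale c (pair_extend scale B f)"
  "pair_extend scale B (word [a, b]) = B a b"
  by (simp_all add: pair_extend_def)

lemma free_map_simps [simp]:
  "free_map h (f + g) = free_map h f + free_map h g"
  "free_map h (free_scale c f) = free_scale c (free_map h f)"
  "free_map h (word xs) = word (map h xs)"
  by (simp_all add: free_map_def)

text \<open>Naturality of Sweedler sums in the source and in the target. The two lemmas reduce identities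
  for the image of a tensor over \<open>\<B>\<close> to identities over \<open>\<B>\<close>.\<close>

lemma pair_extend_free_map:
  assumes "vector_space smul"
  shows "pair_extend smul B (free_map h f) = pair_extend smul (\<lambda>a b. B (h a) (h b)) f"
  unfolding pair_extend_def free_map_def linear_extend_compose[OF assms]
    vector_space.linear_extend_single[OF assms]
  by (rule linear_extend_cong) (auto split: list.splits)

lemma linear_apply_pair_extend:
  assumes "Vector_Spaces.linear s1 s2 L"
  shows "L (pair_extend s1 B f) = pair_extend s2 (\<lambda>a b. L (B a b)) f"
proof -
  interpret L: Vector_Spaces.linear s1 s2 L by fact
  show ?thesis
    unfolding pair_extend_def linear_apply_linear_extend[OF assms]
    by (rule linear_extend_cong) (simp add: L.zero split: list.splits)
qed

lemma free_map_append:
  "free_map h (free_append f g) = free_append (free_map h f) (free_map h g)"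
  by (simp add: free_map_def free_append_eq linear_extend_compose vector_space_free_scale)

lemma free_map_mult:
  assumes "\<And>x y. h (mul x y) = mul' (h x) (h y)"
  shows "free_map h (free_mult mul f g) = free_mult mul' (free_map h f) (free_map h g)"
proof -
  have "map h (map2 mul xs ys) = map2 mul' (map h xs) (map h ys)" for xs ys
    by (simp add: zip_map_map assms case_prod_beta)
  then show ?thesis
    by (simp add: free_map_def free_mult_eq linear_extend_compose vector_space_free_scale if_distrib
        cong: if_cong)
qed

lemma free_map_cong:
  assumes "Vector_Spaces.linear smul smul' h" "f \<approx>\<^bsub>smul\<^esub> g"
  shows "free_map h f \<approx>\<^bsub>smul'\<^esub> free_map h g"
proof -
  interpret h: Vector_Spaces.linear smul smul' h by fact
  have "multilinear_mod smul free_scale (tensor_null smul') (\<lambda>xs. word (map h xs))"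
    using word_add[of "map h _" "h _" "h _" "map h _" smul']
      word_scale[of "map h _" smul' _ "h _" "map h _"]
    by (simp add: multilinear_mod_def tensor_cong_def diff_diff_add h.add h.scale)
  then show ?thesis
    unfolding free_map_def using assms(2) by (rule linear_extend_respects_cong)
qed

lemma tensor_add_class:
  "tensor_add smul (tensor_class smul f) (tensor_class smul g) = tensor_class smul (f + g)"
  by (simp add: tensor_add_def tensor_class_eq_iff tensor_cong_add tensor_rep_class)

lemma tensor_scale_class:
  "tensor_scale smul c (tensor_class smul f) = tensor_class smul (free_scale c f)"
  by (simp add: tensor_scale_def tensor_class_eq_iff tensor_cong_scale tensor_rep_class)

lemma tensor_append_class:
  "tensor_append smul (tensor_class smul f) (tensor_class smul g)
    = tensor_class smul (free_append f g)"
  by (simp add: tensor_append_def tensor_class_eq_iff free_append_cong tensor_rep_class)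

lemma tensor_mult_class:
  assumes "\<And>x. Vector_Spaces.linear smul smul (\<lambda>y. mul x y)"
    and "\<And>y. Vector_Spaces.linear smul smul (\<lambda>x. mul x y)"
  shows "tensor_mult smul mul (tensor_class smul f) (tensor_class smul g)
    = tensor_class smul (free_mult mul f g)"
  by (simp add: tensor_mult_def tensor_class_eq_iff free_mult_cong assms tensor_rep_class)

lemma tensor_map_class:
  assumes "Vector_Spaces.linear smul smul' h"
  shows "tensor_map smul' h (tensor_class smul f) = tensor_class smul' (free_map h f)"
  using free_map_cong[OF assms tensor_rep_class[of smul f]]
  by (simp add: tensor_map_def tensor_class_eq_iff free_extend_eq_linear_extend free_map_def)

lemma sweedler_class:
  assumes left: "\<And>b. Vector_Spaces.linear smul smul' (\<lambda>a. B a b)"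
    and right: "\<And>a. Vector_Spaces.linear smul smul' (\<lambda>b. B a b)"
  shows "sweedler smul' B (tensor_class smul f) = pair_extend smul' B f"
proof -
  interpret l: Vector_Spaces.linear smul smul' "\<lambda>a. B a b" for b by (rule left)
  interpret r: Vector_Spaces.linear smul smul' "\<lambda>b. B a b" for a by (rule right)
  have "multilinear_mod smul smul' {0} (\<lambda>xs. case xs of [a, b] \<Rightarrow> B a b | _ \<Rightarrow> 0)"
    by (rule multilinear_mod_pairs) (simp_all add: l.add r.add l.scale r.scale)
  from l.vs2.linear_extend_respects_cong_eq[OF this tensor_rep_class] show ?thesis
    by (simp add: sweedler_def pair_extend_def linear_extend_def)
qed

text \<open>Tensors do not form a type, so a linear map into tensors is described by representatives, for
  which linearity holds up to null terms.\<close>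

definition linear_lift ::
    "('k::field \<Rightarrow> 'v::ab_group_add \<Rightarrow> 'v) \<Rightarrow> ('v \<Rightarrow> ('v list \<Rightarrow>\<^sub>0 'k)) \<Rightarrow> bool" where
  "linear_lift smul P \<longleftrightarrow>
     (\<forall>a b. P (a + b) \<approx>\<^bsub>smul\<^esub> P a + P b) \<and> (\<forall>c a. P (smul c a) \<approx>\<^bsub>smul\<^esub> free_scale c (P a))"

lemma linear_lift_word: "linear_lift smul (\<lambda>v. word [v])"
  using word_add[of "[]" _ _ "[]" smul] word_scale[of "[]" smul _ _ "[]"]
  by (simp add: linear_lift_def)

lemma pair_extend_append_cong:
  assumes P: "linear_lift smul P" and Q: "linear_lift smul Q" and "f \<approx>\<^bsub>smul\<^esub> g"
  shows "pair_extend free_scale (\<lambda>a b. free_append (P a) (Q b)) f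
    \<approx>\<^bsub>smul\<^esub> pair_extend free_scale (\<lambda>a b. free_append (P a) (Q b)) g"
proof -
  have "multilinear_mod smul free_scale (tensor_null smul)
      (\<lambda>xs. case xs of [a, b] \<Rightarrow> free_append (P a) (Q b) | _ \<Rightarrow> 0)"
  proof (rule multilinear_mod_pairs)
    fix a a' b b' c
    show "free_append (P (a + a')) (Q b) - free_append (P a) (Q b) - free_append (P a') (Q b)
        \<in> tensor_null smul"
      using free_append_cong[of "P (a + a')" smul "P a + P a'" "Q b" "Q b"] P
      by (simp add: linear_lift_def tensor_cong_def diff_diff_add
          free.subspace_0[OF subspace_tensor_null])
    show "free_append (P a) (Q (b + b')) - free_append (P a) (Q b) - free_append (P a) (Q b')
        \<in> tensor_null smul"
      using free_append_cong[of "P a" smul "P a" "Q (b + b')" "Q b + Q b'"] Q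
      by (simp add: linear_lift_def tensor_cong_def diff_diff_add
          free.subspace_0[OF subspace_tensor_null])
    show "free_append (P (smul c a)) (Q b) - free_scale c (free_append (P a) (Q b))
        \<in> tensor_null smul"
      using free_append_cong[of "P (smul c a)" smul "free_scale c (P a)" "Q b" "Q b"] P
      by (simp add: linear_lift_def tensor_cong_def free.subspace_0[OF subspace_tensor_null])
    show "free_append (P a) (Q (smul c b)) - free_scale c (free_append (P a) (Q b))
        \<in> tensor_null smul"
      using free_append_cong[of "P a" smul "P a" "Q (smul c b)" "free_scale c (Q b)"] Q
      by (simp add: linear_lift_def tensor_cong_def free.subspace_0[OF subspace_tensor_null])
  qed (simp_all add: free.subspace_0[OF subspace_tensor_null])
  then show ?thesis
    unfolding pair_extend_def using assms(3) by (rule linear_extend_respects_cong)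
qed

lemma tensor_map2_class:
  assumes P: "linear_lift smul P" and Q: "linear_lift smul Q"
    and p: "\<And>a. p a = tensor_class smul (P a)" and q: "\<And>b. q b = tensor_class smul (Q b)"
  shows "tensor_map2 smul p q (tensor_class smul f)
    = tensor_class smul (pair_extend free_scale (\<lambda>a b. free_append (P a) (Q b)) f)"
proof -
  have "linear_extend free_scale (\<lambda>xs. case xs of
            [a, b] \<Rightarrow> free_append (tensor_rep (p a)) (tensor_rep (q b)) | _ \<Rightarrow> 0)
          (tensor_rep (tensor_class smul f))
      \<approx>\<^bsub>smul\<^esub> pair_extend free_scale (\<lambda>a b. free_append (P a) (Q b))
          (tensor_rep (tensor_class smul f))"
    unfolding pair_extend_def
    by (rule linear_extend_tensor_cong)
      (auto split: list.splits simp: p q intro!: free_append_cong tensor_rep_class)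
  also have "\<dots> \<approx>\<^bsub>smul\<^esub> pair_extend free_scale (\<lambda>a b. free_append (P a) (Q b)) f"
    by (rule pair_extend_append_cong[OF P Q tensor_rep_class])
  finally show ?thesis
    by (simp add: tensor_map2_def tensor_class_eq_iff free_extend_eq_linear_extend)
qed

section \<open>Comultiplication on representatives\<close>

context counital_coalgebra
begin

text \<open>A class also contains representatives with null terms of other degrees. Homogeneous ones are
  chosen because membership in \<open>tensor_power\<close> asks for such a representative, and because a product
  with an annihilated factor can then be read off word by word.\<close>

definition comult_lift :: "'v \<Rightarrow> ('v list \<Rightarrow>\<^sub>0 'k)" where
  "comult_lift x =
     (SOME f. (\<forall>xs\<in>Poly_Mapping.keys f. length xs = 2) \<and> \<Delta> x = tensor_class smul f)"

lemma comult_lift: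
  shows homogeneous_comult_lift: "\<forall>xs\<in>Poly_Mapping.keys (comult_lift x). length xs = 2"
    and comult_eq_class: "\<Delta> x = tensor_class smul (comult_lift x)"
proof -
  have "\<exists>f. (\<forall>xs\<in>Poly_Mapping.keys f. length xs = 2) \<and> \<Delta> x = tensor_class smul f"
    using comult_in[of x] by (auto simp: tensor_power_def)
  from someI_ex[OF this]
  show "\<forall>xs\<in>Poly_Mapping.keys (comult_lift x). length xs = 2"
    and "\<Delta> x = tensor_class smul (comult_lift x)"
    by (simp_all add: comult_lift_def)
qed

lemma linear_lift_comult: "linear_lift smul comult_lift"
  using comult_add comult_scale
  by (simp add: linear_lift_def comult_eq_class tensor_add_class tensor_scale_class
      tensor_class_eq_iff)

lemma coassoc_lift:
  "pair_extend free_scale (\<lambda>a b. free_append (comult_lift a) (word [b])) (comult_lift x)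
    \<approx>\<^bsub>smul\<^esub> pair_extend free_scale (\<lambda>a b. free_append (word [a]) (comult_lift b)) (comult_lift x)"
  using coassoc[of x]
  by (simp add: comult_eq_class[of x] tensor_class_eq_iff pure_tensor_def comult_eq_class
      tensor_map2_class[where P = comult_lift and Q = "\<lambda>v. word [v]"]
      tensor_map2_class[where Q = comult_lift and P = "\<lambda>v. word [v]"]
      linear_lift_comult linear_lift_word)

lemma linear_counit_scale:
  "Vector_Spaces.linear smul smul (\<lambda>a. smul (\<epsilon> a) b)"
  "Vector_Spaces.linear smul smul (\<lambda>b. smul (\<epsilon> a) b)"
proof -
  interpret e: Vector_Spaces.linear smul "(*)" \<epsilon> by (rule linear_counit)
  show "Vector_Spaces.linear smul smul (\<lambda>a. smul (\<epsilon> a) b)"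
    by unfold_locales (simp_all add: e.add e.scale scale_left_distrib)
  show "Vector_Spaces.linear smul smul (\<lambda>b. smul (\<epsilon> a) b)"
    by unfold_locales (simp_all add: scale_right_distrib scale_left_commute)
qed

lemma counit_left_lift: "pair_extend smul (\<lambda>a b. smul (\<epsilon> a) b) (comult_lift x) = x"
  using counit_left[of x]
  by (simp add: comult_eq_class sweedler_class[where smul = smul] linear_counit_scale)

lemma counit_right_lift: "pair_extend smul (\<lambda>a b. smul (\<epsilon> b) a) (comult_lift x) = x"
  using counit_right[of x]
  by (simp add: comult_eq_class sweedler_class[where smul = smul] linear_counit_scale)

end

context bialgebra
begin

lemma comult_lift_mult:
  "comult_lift (mul x y) \<approx>\<^bsub>smul\<^esub> free_mult mul (comult_lift x) (comult_lift y)"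
  using comult_mult[of x y]
  by (simp add: comult_eq_class tensor_mult_class linear_mult_left linear_mult_right
      tensor_class_eq_iff)

lemma comult_lift_one: "comult_lift one \<approx>\<^bsub>smul\<^esub> word [one, one]"
  using comult_one by (simp add: comult_eq_class pure_tensor_def tensor_class_eq_iff)

end

lemma free_mult_three_terms:
  "free_mult mul (a + free_scale s b + free_scale t c) (a' + free_scale s' b' + free_scale t' c')
    = free_mult mul a a'
      + free_scale s (free_mult mul b a') + free_scale t (free_mult mul c a')
      + free_scale s' (free_mult mul a b') + free_scale t' (free_mult mul a c')
      + free_scale (s * s') (free_mult mul b b')
      + free_scale (t * s') (free_mult mul c b') + free_scale (s * t') (free_mult mul b c')
      + free_scale (t * t') (free_mult mul c c')"
  by (simp add: free.scale_right_distrib) (simp add: mult.commute)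

lemma linear_free_map: "Vector_Spaces.linear free_scale free_scale (free_map h)"
  unfolding free_map_def by (rule free.linear_linear_extend)

lemma word2_add_left: "word [a + b, c] \<approx>\<^bsub>smul\<^esub> word [a, c] + word [b, c]"
  using word_add[of "[]" a b "[c]"] by simp

lemma word2_add_right: "word [a, b + c] \<approx>\<^bsub>smul\<^esub> word [a, b] + word [a, c]"
  using word_add[of "[a]" b c "[]"] by simp

lemma word2_zero: "word [0, a] \<approx>\<^bsub>smul\<^esub> 0" "word [a, 0] \<approx>\<^bsub>smul\<^esub> 0"
  using word_zero[of "[]" "[a]" smul] word_zero[of "[a]" "[]" smul] by simp_all

text \<open>A term \<open>a \<otimes> c\<close> is moved from the first summand to the second. The prescribed values of
  \<open>\<Delta>(e)\<close> and \<open>\<Delta>(1)\<close> have the form on the left, with \<open>a = u\<close> and \<open>c = f\<close>.\<close>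

lemma word2_shift: "word [a + b, c] + word [a, d - c] \<approx>\<^bsub>smul\<^esub> word [a, d] + word [b, c]"
proof -
  have "word [a + b, c] + word [a, d - c]
      \<approx>\<^bsub>smul\<^esub> (word [a, c] + word [b, c]) + word [a, d - c]"
    by (intro tensor_cong_add tensor_cong_refl word2_add_left)
  also have "\<dots> = (word [a, d - c] + word [a, c]) + word [b, c]"
    by simp
  also have "\<dots> \<approx>\<^bsub>smul\<^esub> word [a, d - c + c] + word [b, c]"
    by (intro tensor_cong_add tensor_cong_refl tensor_cong_sym[OF word2_add_right])
  finally show ?thesis by simp
qed

section \<open>Product with a group-like and a skew-primitive idempotent\<close>

text \<open>As an algebra the extended space is the product of \<open>\<B>\<close> with two copies of the field, spanned by
  the idempotents \<open>f = e - u\<close> and \<open>g = 1 - e\<close>. This locale describes such a product by its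
  coordinates \<open>p\<close>, \<open>\<sigma>\<close>, \<open>\<tau>\<close>, which are algebra homomorphisms that jointly determine an element. All
  products of \<open>\<iota> b\<close>, \<open>f\<close> and \<open>g\<close> then follow by comparing coordinates.\<close>

locale bialgebra_extension =
  B: bialgebra smul mul u \<Delta> \<epsilon> + V: unital_algebra smul' mul' one'
  for smul :: "'k::field \<Rightarrow> 'b::ab_group_add \<Rightarrow> 'b" and mul u \<Delta> \<epsilon>
    and smul' :: "'k \<Rightarrow> 'v::ab_group_add \<Rightarrow> 'v" and mul' one' +
  fixes \<iota> :: "'b \<Rightarrow> 'v" and f g :: 'v and p :: "'v \<Rightarrow> 'b" and \<sigma> \<tau> :: "'v \<Rightarrow> 'k"
  assumes linear_embed: "Vector_Spaces.linear smul smul' \<iota>"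
    and linear_p: "Vector_Spaces.linear smul' smul p"
    and linear_\<sigma>: "Vector_Spaces.linear smul' (*) \<sigma>"
    and linear_\<tau>: "Vector_Spaces.linear smul' (*) \<tau>"
    and decomposition: "\<iota> (p x) + smul' (\<sigma> x) f + smul' (\<tau> x) g = x"
    and coords_embed [simp]: "p (\<iota> b) = b" "\<sigma> (\<iota> b) = 0" "\<tau> (\<iota> b) = 0"
    and coords_f [simp]: "p f = 0" "\<sigma> f = 1" "\<tau> f = 0"
    and coords_g [simp]: "p g = 0" "\<sigma> g = 0" "\<tau> g = 1"
    and coords_mult [simp]: "p (mul' x y) = mul (p x) (p y)" "\<sigma> (mul' x y) = \<sigma> x * \<sigma> y"
      "\<tau> (mul' x y) = \<tau> x * \<tau> y"
    and coords_one [simp]: "p one' = u" "\<sigma> one' = 1" "\<tau> one' = 1"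
begin

interpretation K: vector_space "(*) :: 'k \<Rightarrow> 'k \<Rightarrow> 'k"
  by unfold_locales (simp_all add: algebra_simps)
interpretation emb: Vector_Spaces.linear smul smul' \<iota> by (rule linear_embed)
interpretation p: Vector_Spaces.linear smul' smul p by (rule linear_p)
interpretation \<sigma>: Vector_Spaces.linear smul' "(*)" \<sigma> by (rule linear_\<sigma>)
interpretation \<tau>: Vector_Spaces.linear smul' "(*)" \<tau> by (rule linear_\<tau>)
interpretation \<epsilon>: Vector_Spaces.linear smul "(*)" \<epsilon> by (rule B.linear_counit)
interpretation mul_right: Vector_Spaces.linear smul smul "\<lambda>y. mul x y" for x
  by (rule B.linear_mult_right)
interpretation mul_left: Vector_Spaces.linear smul smul "\<lambda>x. mul x y" for y
  by (rule B.linear_mult_left)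
interpretation mul'_right: Vector_Spaces.linear smul' smul' "\<lambda>y. mul' x y" for x
  by (rule V.linear_mult_right)
interpretation mul'_left: Vector_Spaces.linear smul' smul' "\<lambda>x. mul' x y" for y
  by (rule V.linear_mult_left)

text \<open>For the field as a vector space over itself, \<open>scale_scale\<close> is associativity of multiplication
  read from right to left, which as a rewrite rule is in conflict with \<open>mult.assoc\<close>.\<close>

declare K.scale_scale [simp del]

lemmas coords_linear = p.add p.scale \<sigma>.add \<sigma>.scale \<tau>.add \<tau>.scale p.zero \<sigma>.zero \<tau>.zero
  mul_right.zero mul_left.zero

lemma coords_eqI: "p x = p y \<Longrightarrow> \<sigma> x = \<sigma> y \<Longrightarrow> \<tau> x = \<tau> y \<Longrightarrow> x = y"
  by (metis decomposition)

lemma products: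
  "mul' f f = f" "mul' g g = g" "mul' f g = 0" "mul' g f = 0"
  "mul' (\<iota> b) f = 0" "mul' f (\<iota> b) = 0" "mul' (\<iota> b) g = 0" "mul' g (\<iota> b) = 0"
  "mul' (\<iota> a) (\<iota> b) = \<iota> (mul a b)"
  by (rule coords_eqI; simp add: coords_linear)+

lemma one_eq: "one' = \<iota> u + f + g"
  by (rule coords_eqI) (simp_all add: coords_linear)

text \<open>The values of the comultiplication: \<open>f\<close> is group-like, and \<open>g\<close> is skew-primitive with
  \<open>\<Delta>(g) = g \<otimes> f + u \<otimes> g\<close>.\<close>

definition comult_f :: "'v list \<Rightarrow>\<^sub>0 'k" where "comult_f = word [f, f]"

definition comult_g :: "'v list \<Rightarrow>\<^sub>0 'k" where "comult_g = word [g, f] + word [\<iota> u, g]"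

definition embedded_comult :: "'b \<Rightarrow> ('v list \<Rightarrow>\<^sub>0 'k)" where
  "embedded_comult b = free_map \<iota> (B.comult_lift b)"

definition comult' :: "'v \<Rightarrow> ('v list \<Rightarrow>\<^sub>0 'k)" where
  "comult' x = embedded_comult (p x) + free_scale (\<sigma> x) comult_f + free_scale (\<tau> x) comult_g"

text \<open>The values are \<open>1\<close> at \<open>f\<close>, as for every group-like element, and \<open>0\<close> at \<open>g\<close>, as for every
  skew-primitive one.\<close>

definition counit' :: "'v \<Rightarrow> 'k" where
  "counit' x = \<epsilon> (p x) + \<sigma> x"

lemma embedded_comult_add:
  "embedded_comult (a + b) \<approx>\<^bsub>smul'\<^esub> embedded_comult a + embedded_comult b"
  unfolding embedded_comult_def free_map_simps(1)[symmetric]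
  using B.linear_lift_comult by (intro free_map_cong[OF linear_embed]) (simp add: linear_lift_def)

lemma embedded_comult_scale:
  "embedded_comult (smul c b) \<approx>\<^bsub>smul'\<^esub> free_scale c (embedded_comult b)"
  unfolding embedded_comult_def free_map_simps(2)[symmetric]
  using B.linear_lift_comult by (intro free_map_cong[OF linear_embed]) (simp add: linear_lift_def)

lemma embedded_comult_zero: "embedded_comult 0 \<approx>\<^bsub>smul'\<^esub> 0"
  using embedded_comult_scale[of 0 0] by simp

lemma embedded_comult_one: "embedded_comult u \<approx>\<^bsub>smul'\<^esub> word [\<iota> u, \<iota> u]"
  using free_map_cong[OF linear_embed B.comult_lift_one] by (simp add: embedded_comult_def)

lemma embedded_comult_mult:
  "embedded_comult (mul a b) \<approx>\<^bsub>smul'\<^esub> free_mult mul' (embedded_comult a) (embedded_comult b)"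
  using free_map_cong[OF linear_embed B.comult_lift_mult]
  by (simp add: embedded_comult_def free_map_mult[where mul' = mul'] products)

lemma linear_lift_comult': "linear_lift smul' comult'"
proof -
  have "comult' (x + y) \<approx>\<^bsub>smul'\<^esub> comult' x + comult' y" for x y
  proof -
    have "comult' (x + y) \<approx>\<^bsub>smul'\<^esub> embedded_comult (p x) + embedded_comult (p y)
        + free_scale (\<sigma> (x + y)) comult_f + free_scale (\<tau> (x + y)) comult_g"
      unfolding comult'_def p.add
      by (intro tensor_cong_add tensor_cong_refl embedded_comult_add)
    also have "\<dots> = comult' x + comult' y"
      by (simp add: comult'_def \<sigma>.add \<tau>.add free.scale_left_distrib)
    finally show ?thesis .
  qed
  moreover have "comult' (smul' c x) \<approx>\<^bsub>smul'\<^esub> free_scale c (comult' x)" for c x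
  proof -
    have "comult' (smul' c x) \<approx>\<^bsub>smul'\<^esub> free_scale c (embedded_comult (p x))
        + free_scale (\<sigma> (smul' c x)) comult_f + free_scale (\<tau> (smul' c x)) comult_g"
      unfolding comult'_def p.scale
      by (intro tensor_cong_add tensor_cong_refl embedded_comult_scale)
    also have "\<dots> = free_scale c (comult' x)"
      by (simp add: comult'_def \<sigma>.scale \<tau>.scale free.scale_right_distrib)
    finally show ?thesis .
  qed
  ultimately show ?thesis by (simp add: linear_lift_def)
qed

lemma comult'_embed: "comult' (\<iota> b) = embedded_comult b"
  by (simp add: comult'_def)

lemma comult'_u: "comult' (\<iota> u) \<approx>\<^bsub>smul'\<^esub> word [\<iota> u, \<iota> u]"
  by (simp add: comult'_embed embedded_comult_one)

lemma comult'_f: "comult' f \<approx>\<^bsub>smul'\<^esub> comult_f"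
  using tensor_cong_add[OF embedded_comult_zero tensor_cong_refl[of comult_f]]
  by (simp add: comult'_def)

lemma comult'_g: "comult' g \<approx>\<^bsub>smul'\<^esub> comult_g"
  using tensor_cong_add[OF embedded_comult_zero tensor_cong_refl[of comult_g]]
  by (simp add: comult'_def)

lemma homogeneous_comult': "\<forall>xs\<in>Poly_Mapping.keys (comult' x). length xs = 2"
proof -
  let ?H = "{h :: 'v list \<Rightarrow>\<^sub>0 'k. \<forall>xs\<in>Poly_Mapping.keys h. length xs = 2}"
  have "embedded_comult (p x) \<in> ?H"
    unfolding embedded_comult_def free_map_def
    by (rule free.linear_extend_in_subspace[OF subspace_homogeneous])
      (simp add: B.homogeneous_comult_lift)
  moreover have "comult_f \<in> ?H" "word [g, f] \<in> ?H" "word [\<iota> u, g] \<in> ?H"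
    by (simp_all add: comult_f_def)
  ultimately have "comult' x \<in> ?H"
    unfolding comult'_def comult_g_def
    by (intro free.subspace_add[OF subspace_homogeneous]
        free.subspace_scale[OF subspace_homogeneous])
  then show ?thesis by simp
qed

lemma pair_extend_embedded:
  assumes "vector_space sc"
  shows "pair_extend sc A (embedded_comult b)
    = pair_extend sc (\<lambda>x y. A (\<iota> x) (\<iota> y)) (B.comult_lift b)"
  by (simp add: embedded_comult_def pair_extend_free_map assms)

text \<open>On \<open>\<B>\<close> this is coassociativity of \<open>\<B>\<close>, transported along the embedding. On \<open>f\<close> and \<open>g\<close> both
  sides are \<open>f \<otimes> f \<otimes> f\<close> and \<open>g \<otimes> f \<otimes> f + u \<otimes> g \<otimes> f + u \<otimes> u \<otimes> g\<close>.\<close>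

lemma coassoc_comult':
  "pair_extend free_scale (\<lambda>a b. free_append (comult' a) (word [b])) (comult' x)
    \<approx>\<^bsub>smul'\<^esub> pair_extend free_scale (\<lambda>a b. free_append (word [a]) (comult' b)) (comult' x)"
    (is "?L (comult' x) \<approx>\<^bsub>smul'\<^esub> ?R (comult' x)")
proof -
  have "?L (embedded_comult b) \<approx>\<^bsub>smul'\<^esub> ?R (embedded_comult b)" for b
  proof -
    have "?L (embedded_comult b) = pair_extend free_scale
        (\<lambda>a b. free_map \<iota> (free_append (B.comult_lift a) (word [b]))) (B.comult_lift b)"
      by (simp add: pair_extend_embedded vector_space_free_scale comult'_embed free_map_append)
        (simp add: embedded_comult_def)
    also have "\<dots> = free_map \<iota> (pair_extend free_scale
        (\<lambda>a b. free_append (B.comult_lift a) (word [b])) (B.comult_lift b))"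
      by (rule linear_apply_pair_extend[OF linear_free_map, symmetric])
    also have "\<dots> \<approx>\<^bsub>smul'\<^esub> free_map \<iota> (pair_extend free_scale
        (\<lambda>a b. free_append (word [a]) (B.comult_lift b)) (B.comult_lift b))"
      by (rule free_map_cong[OF linear_embed B.coassoc_lift])
    also have "\<dots> = pair_extend free_scale
        (\<lambda>a b. free_map \<iota> (free_append (word [a]) (B.comult_lift b))) (B.comult_lift b)"
      by (rule linear_apply_pair_extend[OF linear_free_map])
    also have "\<dots> = ?R (embedded_comult b)"
      by (simp add: pair_extend_embedded vector_space_free_scale comult'_embed free_map_append)
        (simp add: embedded_comult_def)
    finally show ?thesis .
  qed
  moreover have "?L comult_f \<approx>\<^bsub>smul'\<^esub> ?R comult_f"
  proof -
    have "?L comult_f \<approx>\<^bsub>smul'\<^esub> free_append comult_f (word [f])"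
      using free_append_cong[OF comult'_f tensor_cong_refl[of "word [f]"]]
      by (simp add: comult_f_def)
    also have "\<dots> = free_append (word [f]) comult_f"
      by (simp add: comult_f_def)
    also have "\<dots> \<approx>\<^bsub>smul'\<^esub> ?R comult_f"
      using free_append_cong[OF tensor_cong_refl[of "word [f]"] tensor_cong_sym[OF comult'_f]]
      by (simp add: comult_f_def)
    finally show ?thesis .
  qed
  moreover have "?L comult_g \<approx>\<^bsub>smul'\<^esub> ?R comult_g"
  proof -
    have "?L comult_g \<approx>\<^bsub>smul'\<^esub> free_append comult_g (word [f])
        + free_append (word [\<iota> u, \<iota> u]) (word [g])"
      unfolding comult_g_def free.pair_extend_simps unfolding comult_g_def[symmetric]
      by (intro tensor_cong_add free_append_cong comult'_g comult'_u tensor_cong_refl)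
    also have "\<dots> = free_append (word [g]) comult_f + free_append (word [\<iota> u]) comult_g"
      by (simp add: comult_f_def comult_g_def add.assoc)
    also have "\<dots> \<approx>\<^bsub>smul'\<^esub> ?R comult_g"
      unfolding comult_g_def free.pair_extend_simps unfolding comult_g_def[symmetric]
      by (intro tensor_cong_add free_append_cong tensor_cong_refl tensor_cong_sym[OF comult'_g]
          tensor_cong_sym[OF comult'_f])
    finally show ?thesis .
  qed
  ultimately show ?thesis
    unfolding comult'_def[of x] free.pair_extend_simps
    by (intro tensor_cong_add tensor_cong_scale)
qed

lemma linear_counit': "Vector_Spaces.linear smul' (*) counit'"
  by unfold_locales
    (simp_all add: counit'_def coords_linear \<epsilon>.add \<epsilon>.scale algebra_simps)

interpretation \<epsilon>': Vector_Spaces.linear smul' "(*)" counit' by (rule linear_counit')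

lemma counit'_simps [simp]: "counit' (\<iota> b) = \<epsilon> b" "counit' f = 1" "counit' g = 0"
  by (simp_all add: counit'_def \<epsilon>.zero)

lemma counit'_left: "pair_extend smul' (\<lambda>a b. smul' (counit' a) b) (comult' x) = x"
proof -
  have "pair_extend smul' (\<lambda>a b. smul' (counit' a) b) (embedded_comult b) = \<iota> b" for b
    using linear_apply_pair_extend[OF linear_embed, of "\<lambda>a b. smul (\<epsilon> a) b" "B.comult_lift b"]
    by (simp add: pair_extend_embedded V.vector_space_axioms emb.scale B.counit_left_lift)
  then show ?thesis
    using decomposition[of x] by (simp add: comult'_def comult_f_def comult_g_def B.counit_one)
qed

lemma counit'_right: "pair_extend smul' (\<lambda>a b. smul' (counit' b) a) (comult' x) = x"
proof -
  have "pair_extend smul' (\<lambda>a b. smul' (counit' b) a) (embedded_comult b) = \<iota> b" for b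
    using linear_apply_pair_extend[OF linear_embed, of "\<lambda>a b. smul (\<epsilon> b) a" "B.comult_lift b"]
    by (simp add: pair_extend_embedded V.vector_space_axioms emb.scale B.counit_right_lift)
  then show ?thesis
    using decomposition[of x] by (simp add: comult'_def comult_f_def comult_g_def)
qed

text \<open>In \<open>\<Delta>(f)\<close> and \<open>\<Delta>(g)\<close> the second tensor factor is always \<open>f\<close> or \<open>g\<close>, which annihilates \<open>\<B>\<close>. Hence
  all mixed products of \<open>\<Delta>(b)\<close> with \<open>\<Delta>(f)\<close> or \<open>\<Delta>(g)\<close> vanish.\<close>

lemma embedded_comult_mult_annihilated:
  assumes "\<And>a. mul' (\<iota> a) d = 0"
  shows "free_mult mul' (embedded_comult b) (word [c, d]) \<approx>\<^bsub>smul'\<^esub> 0"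
proof -
  have "free_mult mul' (embedded_comult b) (word [c, d])
      = linear_extend free_scale (\<lambda>xs. free_mult mul' (word (map \<iota> xs)) (word [c, d]))
          (B.comult_lift b)"
    by (simp add: embedded_comult_def free_map_def free_mult_eq linear_extend_compose
        vector_space_free_scale)
  also have "\<dots> \<approx>\<^bsub>smul'\<^esub> linear_extend free_scale (\<lambda>xs. 0) (B.comult_lift b)"
  proof (rule linear_extend_tensor_cong)
    fix xs assume "xs \<in> Poly_Mapping.keys (B.comult_lift b)"
    then obtain a a' where "xs = [a, a']"
      using B.homogeneous_comult_lift[of b] by (auto simp: numeral_2_eq_2 length_Suc_conv)
    then show "free_mult mul' (word (map \<iota> xs)) (word [c, d]) \<approx>\<^bsub>smul'\<^esub> 0"
      using word_zero[of "[mul' (\<iota> a) c]" "[]" smul'] by (simp add: assms)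
  qed
  finally show ?thesis by simp
qed

lemma annihilated_mult_embedded_comult:
  assumes "\<And>a. mul' d (\<iota> a) = 0"
  shows "free_mult mul' (word [c, d]) (embedded_comult b) \<approx>\<^bsub>smul'\<^esub> 0"
proof -
  have "free_mult mul' (word [c, d]) (embedded_comult b)
      = linear_extend free_scale (\<lambda>xs. free_mult mul' (word [c, d]) (word (map \<iota> xs)))
          (B.comult_lift b)"
    by (simp add: embedded_comult_def free_map_def free_mult_eq linear_extend_compose
        vector_space_free_scale)
  also have "\<dots> \<approx>\<^bsub>smul'\<^esub> linear_extend free_scale (\<lambda>xs. 0) (B.comult_lift b)"
  proof (rule linear_extend_tensor_cong)
    fix xs assume "xs \<in> Poly_Mapping.keys (B.comult_lift b)"
    then obtain a a' where "xs = [a, a']"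
      using B.homogeneous_comult_lift[of b] by (auto simp: numeral_2_eq_2 length_Suc_conv)
    then show "free_mult mul' (word [c, d]) (word (map \<iota> xs)) \<approx>\<^bsub>smul'\<^esub> 0"
      using word_zero[of "[mul' c (\<iota> a)]" "[]" smul'] by (simp add: assms)
  qed
  finally show ?thesis by simp
qed

text \<open>Orthogonality of \<open>u\<close>, \<open>f\<close> and \<open>g\<close> makes \<open>\<Delta>(f)\<close> and \<open>\<Delta>(g)\<close> orthogonal idempotents; in the square of \<open>\<Delta>(g)\<close> the cross terms contain \<open>g u\<close> or \<open>u g\<close>.\<close>

lemma mult_comult_f_g:
  "free_mult mul' comult_f comult_f = comult_f"
  "free_mult mul' comult_f comult_g \<approx>\<^bsub>smul'\<^esub> 0"
  "free_mult mul' comult_g comult_f \<approx>\<^bsub>smul'\<^esub> 0"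
  "free_mult mul' comult_g comult_g \<approx>\<^bsub>smul'\<^esub> comult_g"
proof -
  show "free_mult mul' comult_f comult_f = comult_f" by (simp add: comult_f_def products)
  show "free_mult mul' comult_f comult_g \<approx>\<^bsub>smul'\<^esub> 0"
    "free_mult mul' comult_g comult_f \<approx>\<^bsub>smul'\<^esub> 0"
    using tensor_cong_add[OF word2_zero(1) word2_zero(1)]
    by (simp_all add: comult_f_def comult_g_def products)
  have "free_mult mul' comult_g comult_g = word [g, f] + word [0, 0] + (word [0, 0] + word [\<iota> u, g])"
    by (simp add: comult_g_def products B.mult_one_left)
  also have "\<dots> \<approx>\<^bsub>smul'\<^esub> word [g, f] + 0 + (0 + word [\<iota> u, g])"
    by (intro tensor_cong_add tensor_cong_refl word2_zero)
  finally show "free_mult mul' comult_g comult_g \<approx>\<^bsub>smul'\<^esub> comult_g" by (simp add: comult_g_def)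
qed

lemma comult'_mult: "comult' (mul' x y) \<approx>\<^bsub>smul'\<^esub> free_mult mul' (comult' x) (comult' y)"
proof -
  let ?E = "\<lambda>x. embedded_comult (p x)"
  have EF: "free_mult mul' (embedded_comult b) comult_f \<approx>\<^bsub>smul'\<^esub> 0" for b
    unfolding comult_f_def by (rule embedded_comult_mult_annihilated) (rule products)
  have FE: "free_mult mul' comult_f (embedded_comult b) \<approx>\<^bsub>smul'\<^esub> 0" for b
    unfolding comult_f_def by (rule annihilated_mult_embedded_comult) (rule products)
  have EG: "free_mult mul' (embedded_comult b) comult_g \<approx>\<^bsub>smul'\<^esub> 0" for b
    using tensor_cong_add[OF embedded_comult_mult_annihilated[of f b g]
        embedded_comult_mult_annihilated[of g b "\<iota> u"]]
    by (simp add: comult_g_def products)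
  have GE: "free_mult mul' comult_g (embedded_comult b) \<approx>\<^bsub>smul'\<^esub> 0" for b
    using tensor_cong_add[OF annihilated_mult_embedded_comult[of f g b]
        annihilated_mult_embedded_comult[of g "\<iota> u" b]]
    by (simp add: comult_g_def products)
  have "free_mult mul' (comult' x) (comult' y) =
      free_mult mul' (?E x) (?E y)
      + free_scale (\<sigma> x) (free_mult mul' comult_f (?E y))
      + free_scale (\<tau> x) (free_mult mul' comult_g (?E y))
      + free_scale (\<sigma> y) (free_mult mul' (?E x) comult_f)
      + free_scale (\<tau> y) (free_mult mul' (?E x) comult_g)
      + free_scale (\<sigma> x * \<sigma> y) (free_mult mul' comult_f comult_f)
      + free_scale (\<tau> x * \<sigma> y) (free_mult mul' comult_g comult_f)
      + free_scale (\<sigma> x * \<tau> y) (free_mult mul' comult_f comult_g)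
      + free_scale (\<tau> x * \<tau> y) (free_mult mul' comult_g comult_g)"
    unfolding comult'_def by (rule free_mult_three_terms)
  also have "\<dots> \<approx>\<^bsub>smul'\<^esub> ?E (mul' x y)
      + free_scale (\<sigma> x) 0 + free_scale (\<tau> x) 0 + free_scale (\<sigma> y) 0 + free_scale (\<tau> y) 0
      + free_scale (\<sigma> x * \<sigma> y) comult_f + free_scale (\<tau> x * \<sigma> y) 0 + free_scale (\<sigma> x * \<tau> y) 0
      + free_scale (\<tau> x * \<tau> y) comult_g"
    unfolding mult_comult_f_g(1) coords_mult(1)
    by (intro tensor_cong_add tensor_cong_scale tensor_cong_refl FE EF GE EG mult_comult_f_g
        tensor_cong_sym[OF embedded_comult_mult])
  also have "\<dots> = comult' (mul' x y)" by (simp add: comult'_def)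
  finally show ?thesis by (rule tensor_cong_sym)
qed

text \<open>With \<open>1 = u + f + g\<close>, the terms \<open>u \<otimes> u\<close>, \<open>f \<otimes> f\<close>, \<open>g \<otimes> f\<close> and \<open>u \<otimes> g\<close> of \<open>\<Delta>(1)\<close> are grouped by
  their first factor \<open>u\<close> and by their second factor \<open>f\<close>. Two pure tensors keep the products in the
  weak unit axioms down to four terms.\<close>

lemma comult'_one: "comult' one' \<approx>\<^bsub>smul'\<^esub> word [\<iota> u, \<iota> u + g] + word [f + g, f]"
proof -
  have "comult' one' \<approx>\<^bsub>smul'\<^esub> word [\<iota> u, \<iota> u] + comult_f + comult_g"
    by (simp add: comult'_def) (intro tensor_cong_add tensor_cong_refl embedded_comult_one)
  also have "\<dots> = (word [\<iota> u, \<iota> u] + word [\<iota> u, g]) + (word [f, f] + word [g, f])"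
    by (simp add: comult_f_def comult_g_def)
  also have "\<dots> \<approx>\<^bsub>smul'\<^esub> word [\<iota> u, \<iota> u + g] + word [f + g, f]"
    by (intro tensor_cong_add tensor_cong_sym[OF word2_add_left]
        tensor_cong_sym[OF word2_add_right])
  finally show ?thesis .
qed

text \<open>The prescribed comultiplication agrees with the one defined through the coordinates. The
  left-hand side uses the basis \<open>e\<close>, \<open>1\<close> and the prescribed values, with \<open>2 u - e = u - f\<close> and
  \<open>1 - 2 e + 2 u = u + g - f\<close>.\<close>

lemma comult'_adjoined:
  assumes e: "e = \<iota> u + f"
  shows "embedded_comult b + free_scale s (word [e, f] + word [\<iota> u, \<iota> u - f])
      + free_scale t (word [one', f] + word [\<iota> u, \<iota> u + g - f])
    \<approx>\<^bsub>smul'\<^esub> comult' (\<iota> b + smul' s e + smul' t one')"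
proof -
  have "word [e, f] + word [\<iota> u, \<iota> u - f] \<approx>\<^bsub>smul'\<^esub> word [\<iota> u, \<iota> u] + word [f, f]"
    unfolding e by (rule word2_shift)
  also have "\<dots> \<approx>\<^bsub>smul'\<^esub> comult' (\<iota> u) + comult' f"
    by (intro tensor_cong_add tensor_cong_sym[OF comult'_u]
        tensor_cong_sym[OF comult'_f[unfolded comult_f_def]])
  also have "\<dots> \<approx>\<^bsub>smul'\<^esub> comult' e"
    using linear_lift_comult' by (simp add: e linear_lift_def tensor_cong_sym)
  finally have 1: "word [e, f] + word [\<iota> u, \<iota> u - f] \<approx>\<^bsub>smul'\<^esub> comult' e" .
  have "word [one', f] + word [\<iota> u, \<iota> u + g - f] \<approx>\<^bsub>smul'\<^esub> word [\<iota> u, \<iota> u + g] + word [f + g, f]"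
    unfolding one_eq add.assoc by (rule word2_shift)
  also have "\<dots> \<approx>\<^bsub>smul'\<^esub> comult' one'"
    by (rule tensor_cong_sym[OF comult'_one])
  finally have 2: "word [one', f] + word [\<iota> u, \<iota> u + g - f] \<approx>\<^bsub>smul'\<^esub> comult' one'" .
  have add: "comult' x + comult' y \<approx>\<^bsub>smul'\<^esub> comult' (x + y)"
    and scale: "free_scale c (comult' x) \<approx>\<^bsub>smul'\<^esub> comult' (smul' c x)" for x y c
    using linear_lift_comult' by (simp_all add: linear_lift_def tensor_cong_sym)
  have "embedded_comult b + free_scale s (word [e, f] + word [\<iota> u, \<iota> u - f])
      + free_scale t (word [one', f] + word [\<iota> u, \<iota> u + g - f])
    \<approx>\<^bsub>smul'\<^esub> comult' (\<iota> b) + free_scale s (comult' e) + free_scale t (comult' one')"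
    unfolding comult'_embed by (intro tensor_cong_add tensor_cong_scale tensor_cong_refl 1 2)
  also have "\<dots> \<approx>\<^bsub>smul'\<^esub> comult' (\<iota> b) + comult' (smul' s e) + comult' (smul' t one')"
    by (intro tensor_cong_add tensor_cong_refl scale)
  also have "\<dots> \<approx>\<^bsub>smul'\<^esub> comult' (\<iota> b + smul' s e) + comult' (smul' t one')"
    by (intro tensor_cong_add tensor_cong_refl add)
  also have "\<dots> \<approx>\<^bsub>smul'\<^esub> comult' (\<iota> b + smul' s e + smul' t one')"
    by (rule add)
  finally show ?thesis .
qed

lemma comult'_comult'_one:
  "pair_extend free_scale (\<lambda>a b. free_append (comult' a) (word [b])) (comult' one')
    \<approx>\<^bsub>smul'\<^esub> word [\<iota> u, \<iota> u, \<iota> u + g] + word [f + g, f, f] + word [\<iota> u, g, f]"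
  (is "?L (comult' one') \<approx>\<^bsub>smul'\<^esub> _")
proof -
  \<comment> \<open>The terms \<open>f \<otimes> f\<close> and \<open>g \<otimes> f\<close> are kept together, to match the grouping of \<open>\<Delta>(1)\<close>.\<close>
  have *: "comult' (f + g) \<approx>\<^bsub>smul'\<^esub> word [f + g, f] + word [\<iota> u, g]"
  proof -
    have "comult' (f + g) \<approx>\<^bsub>smul'\<^esub> comult' f + comult' g"
      using linear_lift_comult' by (simp add: linear_lift_def)
    also have "\<dots> \<approx>\<^bsub>smul'\<^esub> comult_f + comult_g"
      by (intro tensor_cong_add comult'_f comult'_g)
    also have "\<dots> = (word [f, f] + word [g, f]) + word [\<iota> u, g]"
      by (simp add: comult_f_def comult_g_def)
    also have "\<dots> \<approx>\<^bsub>smul'\<^esub> word [f + g, f] + word [\<iota> u, g]"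
      by (intro tensor_cong_add tensor_cong_refl tensor_cong_sym[OF word2_add_left])
    finally show ?thesis .
  qed
  have "?L (comult' one') \<approx>\<^bsub>smul'\<^esub> ?L (word [\<iota> u, \<iota> u + g] + word [f + g, f])"
    by (rule pair_extend_append_cong[OF linear_lift_comult' linear_lift_word comult'_one])
  also have "\<dots> = free_append (comult' (\<iota> u)) (word [\<iota> u + g])
      + free_append (comult' (f + g)) (word [f])"
    by simp
  also have "\<dots> \<approx>\<^bsub>smul'\<^esub> free_append (word [\<iota> u, \<iota> u]) (word [\<iota> u + g])
      + free_append (word [f + g, f] + word [\<iota> u, g]) (word [f])"
    by (intro tensor_cong_add free_append_cong tensor_cong_refl comult'_u *)
  finally show ?thesis by (simp add: add.assoc)
qed

text \<open>Both orders give the same result because the middle factors lie in the span of the commuting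
  idempotents \<open>u\<close>, \<open>f\<close>, \<open>g\<close>. One of the four terms has middle factor \<open>f u = u f = 0\<close>, and the
  other three are those of \<open>(\<Delta> \<otimes> id) \<Delta>(1)\<close>.\<close>

lemma weak_comult'_one:
  "free_mult mul' (free_append (comult' one') (word [one']))
      (free_append (word [one']) (comult' one'))
    \<approx>\<^bsub>smul'\<^esub> word [\<iota> u, \<iota> u, \<iota> u + g] + word [f + g, f, f] + word [\<iota> u, g, f]" (is ?left)
  "free_mult mul' (free_append (word [one']) (comult' one'))
      (free_append (comult' one') (word [one']))
    \<approx>\<^bsub>smul'\<^esub> word [\<iota> u, \<iota> u, \<iota> u + g] + word [f + g, f, f] + word [\<iota> u, g, f]" (is ?right)
proof -
  let ?T = "word [\<iota> u, \<iota> u + g] + word [f + g, f] :: 'v list \<Rightarrow>\<^sub>0 'k"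
  let ?A = "free_append ?T (word [one'])" and ?B = "free_append (word [one']) ?T"
  have middle: "mul' (\<iota> u + g) (\<iota> u) = \<iota> u" "mul' (\<iota> u + g) (f + g) = g"
    "mul' f (\<iota> u) = 0" "mul' f (f + g) = f"
    "mul' (\<iota> u) (\<iota> u + g) = \<iota> u" "mul' (f + g) (\<iota> u + g) = g"
    "mul' (\<iota> u) f = 0" "mul' (f + g) f = f"
    by (rule coords_eqI; simp add: coords_linear B.mult_one_left)+
  have zero: "word [f + g, 0, \<iota> u + g] \<approx>\<^bsub>smul'\<^esub> 0"
    using word_zero[of "[f + g]" "[\<iota> u + g]" smul'] by simp
  have expand: "word [\<iota> u, \<iota> u, \<iota> u + g] + word [f + g, f, f] + word [\<iota> u, g, f]
        + word [f + g, 0, \<iota> u + g]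
      \<approx>\<^bsub>smul'\<^esub> word [\<iota> u, \<iota> u, \<iota> u + g] + word [f + g, f, f] + word [\<iota> u, g, f]"
    using tensor_cong_add[OF tensor_cong_refl zero] by simp
  note cong = free_mult_cong[OF V.linear_mult_right V.linear_mult_left]
  have "free_mult mul' (free_append (comult' one') (word [one']))
      (free_append (word [one']) (comult' one')) \<approx>\<^bsub>smul'\<^esub> free_mult mul' ?A ?B"
    by (rule cong; rule free_append_cong; rule comult'_one tensor_cong_refl)
  also have "free_mult mul' ?A ?B = word [\<iota> u, \<iota> u, \<iota> u + g] + word [f + g, f, f]
      + word [\<iota> u, g, f] + word [f + g, 0, \<iota> u + g]"
    by (simp add: V.mult_one_left V.mult_one_right middle)
  also note expand
  finally show ?left .
  have "free_mult mul' (free_append (word [one']) (comult' one'))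
      (free_append (comult' one') (word [one'])) \<approx>\<^bsub>smul'\<^esub> free_mult mul' ?B ?A"
    by (rule cong; rule free_append_cong; rule comult'_one tensor_cong_refl)
  also have "free_mult mul' ?B ?A = word [\<iota> u, \<iota> u, \<iota> u + g] + word [f + g, f, f]
      + word [\<iota> u, g, f] + word [f + g, 0, \<iota> u + g]"
    by (simp add: V.mult_one_left V.mult_one_right middle)
  also note expand
  finally show ?right .
qed

text \<open>On \<open>\<B>\<close> multiplicativity of \<open>\<epsilon>\<close> turns the Sweedler sum into \<open>\<epsilon>(x) \<epsilon>(z)\<close> times the sum of
  \<open>\<epsilon>(y\<^sub>1) \<epsilon>(y\<^sub>2)\<close>, which is \<open>\<epsilon>(y)\<close> by the counit law. For \<open>y = f\<close> both sides are the product of the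
  \<open>f\<close>-coordinates of \<open>x\<close> and \<open>z\<close>. For \<open>y = g\<close> both sides vanish, since \<open>\<epsilon>(x g) = \<epsilon>(g z) = 0\<close>.\<close>

lemma weak_counit'_mult:
  "counit' (mul' (mul' x y) z)
    = pair_extend (*) (\<lambda>y1 y2. counit' (mul' x y1) * counit' (mul' y2 z)) (comult' y)"
proof -
  define c where "c = \<epsilon> (p x) * \<epsilon> (p z)"
  have lin: "Vector_Spaces.linear smul (*) (\<lambda>v. c * \<epsilon> v)"
    by unfold_locales (simp_all add: \<epsilon>.add \<epsilon>.scale algebra_simps)
  have "pair_extend (*) (\<lambda>y1 y2. counit' (mul' x y1) * counit' (mul' y2 z)) (embedded_comult b)
      = pair_extend (*) (\<lambda>a b. c * \<epsilon> (smul (\<epsilon> a) b)) (B.comult_lift b)" for b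
    by (simp add: pair_extend_embedded K.vector_space_axioms counit'_def B.counit_mult c_def
        \<epsilon>.scale mult_ac)
  then have *: "pair_extend (*) (\<lambda>y1 y2. counit' (mul' x y1) * counit' (mul' y2 z))
      (embedded_comult b) = c * \<epsilon> b" for b
    using linear_apply_pair_extend[OF lin, of "\<lambda>a b. smul (\<epsilon> a) b" "B.comult_lift b"]
    by (simp add: B.counit_left_lift)
  show ?thesis
    by (simp add: comult'_def * comult_f_def comult_g_def)
      (simp add: counit'_def B.counit_mult c_def mul_left.zero mul_right.zero \<epsilon>.zero)
qed

theorem weak_bialgebra_extension:
  assumes \<Delta>': "\<And>x. \<Delta>' x = tensor_class smul' (comult' x)"
  shows "weak_bialgebra smul' mul' one' \<Delta>' counit'"
proof (intro weak_bialgebra.intro counital_coalgebra.intro counital_coalgebra_axioms.intro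
    weak_bialgebra_axioms.intro V.unital_algebra_axioms V.vector_space_axioms)
  show "\<Delta>' x \<in> tensor_power smul' 2" for x
    using homogeneous_comult'[of x] by (simp add: \<Delta>' tensor_power_def)
  show "\<Delta>' (x + y) = tensor_add smul' (\<Delta>' x) (\<Delta>' y)" for x y
    using linear_lift_comult'
    by (simp add: \<Delta>' tensor_add_class tensor_class_eq_iff linear_lift_def)
  show "\<Delta>' (smul' c x) = tensor_scale smul' c (\<Delta>' x)" for c x
    using linear_lift_comult'
    by (simp add: \<Delta>' tensor_scale_class tensor_class_eq_iff linear_lift_def)
  show "Vector_Spaces.linear smul' (*) counit'" by (rule linear_counit')
  note map2 = tensor_map2_class[OF linear_lift_comult' linear_lift_word \<Delta>' pure_tensor_def]
    tensor_map2_class[OF linear_lift_word linear_lift_comult' pure_tensor_def \<Delta>']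
  show "tensor_map2 smul' \<Delta>' (\<lambda>v. pure_tensor smul' [v]) (\<Delta>' x)
      = tensor_map2 smul' (\<lambda>v. pure_tensor smul' [v]) \<Delta>' (\<Delta>' x)" for x
    by (simp add: \<Delta>'[of x] map2 tensor_class_eq_iff coassoc_comult')
  have lin: "Vector_Spaces.linear smul' smul' (\<lambda>a. smul' (counit' a) b)"
    "Vector_Spaces.linear smul' smul' (\<lambda>a. smul' (counit' b) a)" for b
    by unfold_locales (simp_all add: \<epsilon>'.add \<epsilon>'.scale V.scale_left_distrib V.scale_right_distrib
        V.scale_left_commute)
  show "sweedler smul' (\<lambda>a b. smul' (counit' a) b) (\<Delta>' x) = x" for x
    by (simp add: \<Delta>' sweedler_class[OF lin] counit'_left)
  show "sweedler smul' (\<lambda>a b. smul' (counit' b) a) (\<Delta>' x) = x" for x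
    by (simp add: \<Delta>' sweedler_class[OF lin(2) lin(1)] counit'_right)
  note mult = tensor_mult_class[OF V.linear_mult_right V.linear_mult_left]
  show "\<Delta>' (mul' x y) = tensor_mult smul' mul' (\<Delta>' x) (\<Delta>' y)" for x y
    by (simp add: \<Delta>' mult tensor_class_eq_iff comult'_mult)
  show "tensor_map2 smul' \<Delta>' (\<lambda>v. pure_tensor smul' [v]) (\<Delta>' one') =
       tensor_mult smul' mul' (tensor_append smul' (\<Delta>' one') (pure_tensor smul' [one']))
                              (tensor_append smul' (pure_tensor smul' [one']) (\<Delta>' one'))"
    using tensor_cong_trans[OF comult'_comult'_one tensor_cong_sym[OF weak_comult'_one(1)]]
    by (simp add: \<Delta>'[of one'] map2 pure_tensor_def[of smul' "[one']"] tensor_append_class mult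
        tensor_class_eq_iff)
  show "tensor_map2 smul' \<Delta>' (\<lambda>v. pure_tensor smul' [v]) (\<Delta>' one') =
       tensor_mult smul' mul' (tensor_append smul' (pure_tensor smul' [one']) (\<Delta>' one'))
                              (tensor_append smul' (\<Delta>' one') (pure_tensor smul' [one']))"
    using tensor_cong_trans[OF comult'_comult'_one tensor_cong_sym[OF weak_comult'_one(2)]]
    by (simp add: \<Delta>'[of one'] map2 pure_tensor_def[of smul' "[one']"] tensor_append_class mult
        tensor_class_eq_iff)
  have "Vector_Spaces.linear smul' (*) (\<lambda>a. counit' (mul' x a) * counit' (mul' b z))"
    "Vector_Spaces.linear smul' (*) (\<lambda>b. counit' (mul' x a) * counit' (mul' b z))" for x z a b
    by unfold_locales (simp_all add: mul'_left.add mul'_right.add mul'_left.scale mul'_right.scale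
        \<epsilon>'.add \<epsilon>'.scale algebra_simps)
  then show "counit' (mul' (mul' x y) z)
      = sweedler (*) (\<lambda>y1 y2. counit' (mul' x y1) * counit' (mul' y2 z)) (\<Delta>' y)" for x y z
    by (simp add: \<Delta>' sweedler_class[where smul = smul'] weak_counit'_mult)
qed

end

section \<open>Adjoining units\<close>

lemma adjoin_scale_Pair [simp]:
  assumes "vector_space smul"
  shows "adjoin_scale smul c (a, s) = (smul c a, c * s)"
proof -
  interpret vector_space smul by fact
  interpret vector_space_prod smul "(*) :: 'a \<Rightarrow> 'a \<Rightarrow> 'a"
    by unfold_locales (simp_all add: algebra_simps)
  show ?thesis by (simp add: adjoin_scale_def scale_prod)
qed

lemma vector_space_adjoin:
  assumes "vector_space smul"
  shows "vector_space (adjoin_scale smul)"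
proof -
  interpret vector_space smul by fact
  interpret vector_space_prod smul "(*) :: 'a \<Rightarrow> 'a \<Rightarrow> 'a"
    by unfold_locales (simp_all add: algebra_simps)
  show ?thesis unfolding adjoin_scale_def by (rule p.vector_space_axioms)
qed

lemma adjoin_mult_Pair [simp]:
  "adjoin_mult smul mul (a, s) (b, t) = (mul a b + smul t a + smul s b, s * t)"
  by (simp add: adjoin_mult_def)

lemma unital_algebra_adjoin:
  assumes "unital_algebra smul mul one"
  shows "unital_algebra (adjoin_scale smul) (adjoin_mult smul mul) adjoin_unit"
proof -
  interpret A: unital_algebra smul mul one by fact
  interpret r: Vector_Spaces.linear smul smul "\<lambda>y. mul x y" for x by (rule A.linear_mult_right)
  interpret l: Vector_Spaces.linear smul smul "\<lambda>x. mul x y" for y by (rule A.linear_mult_left)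
  interpret W: vector_space "adjoin_scale smul"
    by (rule vector_space_adjoin) (rule A.vector_space_axioms)
  note [simp] = adjoin_scale_Pair[OF A.vector_space_axioms]
  have mult: "adjoin_mult smul mul x (y + z) = adjoin_mult smul mul x y + adjoin_mult smul mul x z"
    "adjoin_mult smul mul (y + z) x = adjoin_mult smul mul y x + adjoin_mult smul mul z x"
    "adjoin_mult smul mul x (adjoin_scale smul c y) = adjoin_scale smul c (adjoin_mult smul mul x y)"
    "adjoin_mult smul mul (adjoin_scale smul c y) x = adjoin_scale smul c (adjoin_mult smul mul y x)"
    "adjoin_mult smul mul (adjoin_mult smul mul x y) z
      = adjoin_mult smul mul x (adjoin_mult smul mul y z)"
    "adjoin_mult smul mul adjoin_unit x = x" "adjoin_mult smul mul x adjoin_unit = x" for x y z c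
  proof -
    obtain a s b t d r where "x = (a, s)" "y = (b, t)" "z = (d, r)"
      by (metis surj_pair)
    then show "adjoin_mult smul mul x (y + z) = adjoin_mult smul mul x y + adjoin_mult smul mul x z"
      "adjoin_mult smul mul (y + z) x = adjoin_mult smul mul y x + adjoin_mult smul mul z x"
      "adjoin_mult smul mul x (adjoin_scale smul c y)
        = adjoin_scale smul c (adjoin_mult smul mul x y)"
      "adjoin_mult smul mul (adjoin_scale smul c y) x
        = adjoin_scale smul c (adjoin_mult smul mul y x)"
      "adjoin_mult smul mul (adjoin_mult smul mul x y) z
        = adjoin_mult smul mul x (adjoin_mult smul mul y z)"
      "adjoin_mult smul mul adjoin_unit x = x" "adjoin_mult smul mul x adjoin_unit = x"
      by (simp_all add: adjoin_unit_def A.mult_assoc r.add l.add r.scale l.scale r.zero l.zero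
          A.scale_left_distrib A.scale_right_distrib algebra_simps)
  qed
  show ?thesis
  proof (intro unital_algebra.intro unital_algebra_axioms.intro W.vector_space_axioms)
    show "Vector_Spaces.linear (adjoin_scale smul) (adjoin_scale smul)
        (\<lambda>y. adjoin_mult smul mul x y)" for x
      by unfold_locales (simp_all add: mult)
    show "Vector_Spaces.linear (adjoin_scale smul) (adjoin_scale smul)
        (\<lambda>x. adjoin_mult smul mul x y)" for y
      by unfold_locales (simp_all add: mult)
  qed (simp_all add: mult)
qed

theorem proposition2p15:
  fixes smul :: "'k::{alg_closed_field, field_char_0} \<Rightarrow> 'b::ab_group_add \<Rightarrow> 'b"
    and mul :: "'b \<Rightarrow> 'b \<Rightarrow> 'b" and u\<^sub>B :: 'b
    and \<Delta> :: "'b \<Rightarrow> ('k, 'b) tensor" and \<epsilon> :: "'b \<Rightarrow> 'k"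
  assumes "bialgebra smul mul u\<^sub>B \<Delta> \<epsilon>"
  shows "let
      smul' = adjoin_scale (adjoin_scale smul);
      mul' = adjoin_mult (adjoin_scale smul) (adjoin_mult smul mul);
      u = adjoin_embed (adjoin_embed u\<^sub>B);
      e = adjoin_embed adjoin_unit;
      one = adjoin_unit;
      \<Delta>1 = tensor_add smul' (pure_tensor smul' [one, e - u])
             (pure_tensor smul' [u, one - smul' 2 e + smul' 2 u]);
      \<Delta>e = tensor_add smul' (pure_tensor smul' [e, e - u])
             (pure_tensor smul' [u, smul' 2 u - e])
    in weak_bialgebra smul' mul' one
         (extend_comult smul \<Delta> \<Delta>e \<Delta>1) (extend_counit \<epsilon> 2 2)"
proof -
  interpret B: bialgebra smul mul u\<^sub>B \<Delta> \<epsilon> by fact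
  let ?smul' = "adjoin_scale (adjoin_scale smul)"
  let ?mul' = "adjoin_mult (adjoin_scale smul) (adjoin_mult smul mul)"
  define \<iota> :: "'b \<Rightarrow> ('b \<times> 'k) \<times> 'k" where "\<iota> b = adjoin_embed (adjoin_embed b)" for b
  define e :: "('b \<times> 'k) \<times> 'k" where "e = adjoin_embed adjoin_unit"
  define one :: "('b \<times> 'k) \<times> 'k" where "one = adjoin_unit"
  \<comment> \<open>The coordinates of \<open>b + s e + t 1 = (b + s u + t u) + (s + t) f + t g\<close>,
    from \<open>e = u + f\<close> and \<open>1 = u + f + g\<close>.\<close>
  define p :: "('b \<times> 'k) \<times> 'k \<Rightarrow> 'b"
    where "p = (\<lambda>((b, s), t). b + smul s u\<^sub>B + smul t u\<^sub>B)"
  define \<sigma> :: "('b \<times> 'k) \<times> 'k \<Rightarrow> 'k" where "\<sigma> = (\<lambda>((b, s), t). s + t)"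
  define \<tau> :: "('b \<times> 'k) \<times> 'k \<Rightarrow> 'k" where "\<tau> = (\<lambda>((b, s), t). t)"
  interpret A: unital_algebra "adjoin_scale smul" "adjoin_mult smul mul" adjoin_unit
    by (rule unital_algebra_adjoin) (rule B.unital_algebra_axioms)
  interpret V: unital_algebra ?smul' ?mul' one
    unfolding one_def by (rule unital_algebra_adjoin) (rule A.unital_algebra_axioms)
  note [simp] = adjoin_scale_Pair[OF B.vector_space_axioms]
    adjoin_scale_Pair[OF A.vector_space_axioms]
  interpret r: Vector_Spaces.linear smul smul "\<lambda>y. mul x y" for x by (rule B.linear_mult_right)
  interpret l: Vector_Spaces.linear smul smul "\<lambda>x. mul x y" for y by (rule B.linear_mult_left)
  note defs = \<iota>_def e_def one_def p_def \<sigma>_def \<tau>_def adjoin_embed_def adjoin_unit_def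
    zero_prod_def
  interpret E: bialgebra_extension smul mul u\<^sub>B \<Delta> \<epsilon> ?smul' ?mul' one
    \<iota> "e - \<iota> u\<^sub>B" "one - e" p \<sigma> \<tau>
  proof unfold_locales
    show "\<iota> (p x) + ?smul' (\<sigma> x) (e - \<iota> u\<^sub>B) + ?smul' (\<tau> x) (one - e) = x" for x
    proof -
      obtain b s t where "x = ((b, s), t)" by (metis surj_pair)
      then show ?thesis by (simp add: defs B.scale_left_distrib)
    qed
    show "p (?mul' x y) = mul (p x) (p y)" "\<sigma> (?mul' x y) = \<sigma> x * \<sigma> y"
      "\<tau> (?mul' x y) = \<tau> x * \<tau> y" for x y
    proof -
      obtain a s t b s' t' where "x = ((a, s), t)" "y = ((b, s'), t')"
        by (metis surj_pair)
      then show "p (?mul' x y) = mul (p x) (p y)" "\<sigma> (?mul' x y) = \<sigma> x * \<sigma> y"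
        "\<tau> (?mul' x y) = \<tau> x * \<tau> y"
        by (simp_all add: defs r.add l.add r.scale l.scale B.mult_one_left B.mult_one_right
            B.scale_left_distrib B.scale_right_distrib algebra_simps)
    qed
  qed (auto simp: defs B.scale_left_distrib B.scale_right_distrib algebra_simps)
  interpret \<epsilon>: Vector_Spaces.linear smul "(*)" \<epsilon> by (rule B.linear_counit)
  have counit: "extend_counit \<epsilon> 2 2 = E.counit'"
  proof
    fix x :: "('b \<times> 'k) \<times> 'k"
    obtain b s t where "x = ((b, s), t)" by (metis surj_pair)
    then have "p x = b + smul s u\<^sub>B + smul t u\<^sub>B" "\<sigma> x = s + t"
      and "extend_counit \<epsilon> 2 2 x = \<epsilon> b + s * 2 + t * 2"
      by (simp_all add: p_def \<sigma>_def extend_counit_def)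
    then show "extend_counit \<epsilon> 2 2 x = E.counit' x"
      by (simp add: E.counit'_def \<epsilon>.add \<epsilon>.scale B.counit_one mult_2_right)
  qed
  have emb: "tensor_map ?smul' (\<lambda>v. adjoin_embed (adjoin_embed v)) (\<Delta> b)
      = tensor_class ?smul' (E.embedded_comult b)" for b
    using tensor_map_class[OF E.linear_embed, of "B.comult_lift b"]
    by (simp add: B.comult_eq_class E.embedded_comult_def flip: \<iota>_def)
  have arg: "?smul' 2 (\<iota> u\<^sub>B) - e = \<iota> u\<^sub>B - (e - \<iota> u\<^sub>B)"
    "one - ?smul' 2 e + ?smul' 2 (\<iota> u\<^sub>B) = \<iota> u\<^sub>B + (one - e) - (e - \<iota> u\<^sub>B)"
    using V.scale_left_distrib[of 1 1 e] V.scale_left_distrib[of 1 1 "\<iota> u\<^sub>B"]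
    by (simp_all add: algebra_simps)
  have comult: "extend_comult smul \<Delta>
        (tensor_add ?smul' (pure_tensor ?smul' [e, e - \<iota> u\<^sub>B])
          (pure_tensor ?smul' [\<iota> u\<^sub>B, ?smul' 2 (\<iota> u\<^sub>B) - e]))
        (tensor_add ?smul' (pure_tensor ?smul' [one, e - \<iota> u\<^sub>B])
          (pure_tensor ?smul' [\<iota> u\<^sub>B, one - ?smul' 2 e + ?smul' 2 (\<iota> u\<^sub>B)])) x
      = tensor_class ?smul' (E.comult' x)" for x
  proof -
    obtain b s t where x: "x = ((b, s), t)" by (metis surj_pair)
    have "\<iota> b + ?smul' s e + ?smul' t one = x"
      by (simp add: x defs)
    then show ?thesis
      using E.comult'_adjoined[of e b s t]
      by (simp add: x extend_comult_def emb pure_tensor_def tensor_add_class tensor_scale_class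
          tensor_class_eq_iff arg)
  qed
  show ?thesis
    using E.weak_bialgebra_extension[OF comult]
    by (simp add: counit \<iota>_def e_def one_def Let_def)
qed

end
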